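(* Let $g\in H(\mathbb{D})$ and $0<p<\infty$. Then the operator $S_g\colon H^p\to H^p$ is bounded if and only if $g\in H^\infty$.
   Context: $\mathbb{D}$ is the open unit disk in $\mathbb{C}$, $H(\mathbb{D})$ is the space of analytic functions on $\mathbb{D}$, and $m$ is the normalized Lebesgue measure on $\partial\mathbb{D}$. For $0<p<\infty$, the Hardy space $H^p$ consists of all $f\in H(\mathbb{D})$ with $\|f\|_{H^p}=\left(\lim_{r\to1^-}\int_{\partial\mathbb{D}}|f(r\xi)|^p\,dm(\xi)\right)^{1/p}<\infty$. $H^\infty$ is the space of $f\in H(\mathbb{D})$ with $\sup_{z\in\mathbb{D}}|f(z)|<\infty$. For $g\in H(\mathbb{D})$, the Volterra type operator $S_g$ is defined by $(S_gf)(z)=\int_0^z f'(\omega)g(\omega)\,d\omega$ for $z\in\mathbb{D}$, $f\in H(\mathbb{D})$. *)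

theory Defs
  imports "HOL-Complex_Analysis.Complex_Analysis"
begin

abbreviation unit_disk :: "complex set" where
  "unit_disk \<equiv> ball 0 1"

text \<open>
  The underlying sigma-algebra is that of the circle itself, not of the whole plane: functions on
  the disk are total functions with arbitrary values outside the disk, so \<open>\<lambda>\<xi>. f (r * \<xi>)\<close> need only be
  measurable on the circle.
\<close>
definition circle_measure :: "complex measure" where
  "circle_measure =
     distr (uniform_measure lborel {0..2 * pi}) (restrict_space borel (sphere 0 1)) cis"

definition hardy_mean :: "real \<Rightarrow> (complex \<Rightarrow> complex) \<Rightarrow> real \<Rightarrow> real" where
  "hardy_mean p f r = (LINT \<xi>|circle_measure. cmod (f (of_real r * \<xi>)) powr p)"

text \<open>For holomorphic \<open>f\<close> the means are real and nondecreasing in \<open>r < 1\<close>, so the limit being finite is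
  the same as convergence in the reals.\<close>
definition hardy_space :: "real \<Rightarrow> (complex \<Rightarrow> complex) set" where
  "hardy_space p =
     {f. f holomorphic_on unit_disk \<and> (\<exists>L. (hardy_mean p f \<longlongrightarrow> L) (at_left 1))}"

definition hardy_norm :: "real \<Rightarrow> (complex \<Rightarrow> complex) \<Rightarrow> real" where
  "hardy_norm p f = (Lim (at_left 1) (hardy_mean p f)) powr (1 / p)"

definition hardy_space_infinity :: "(complex \<Rightarrow> complex) set" where
  "hardy_space_infinity = {f. f holomorphic_on unit_disk \<and> bounded (f ` unit_disk)}"

definition volterra_S :: "(complex \<Rightarrow> complex) \<Rightarrow> (complex \<Rightarrow> complex) \<Rightarrow> complex \<Rightarrow> complex" where
  "volterra_S g f z = contour_integral (linepath 0 z) (\<lambda>w. deriv f w * g w)"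

text \<open>Only used for linear \<open>T\<close>. For \<open>p < 1\<close> the functional \<^term>\<open>hardy_norm p\<close> is merely a quasi-norm,
  and this is the usual notion of boundedness there as well.\<close>
definition bounded_on_hardy_space ::
    "real \<Rightarrow> ((complex \<Rightarrow> complex) \<Rightarrow> complex \<Rightarrow> complex) \<Rightarrow> bool" where
  "bounded_on_hardy_space p T \<longleftrightarrow>
     (\<forall>f\<in>hardy_space p. T f \<in> hardy_space p) \<and>
     (\<exists>C. \<forall>f\<in>hardy_space p. hardy_norm p (T f) \<le> C * hardy_norm p f)"

lemma cis_measurable_sphere:
  "cis \<in> measurable (uniform_measure lborel {0..2 * pi}) (restrict_space borel (sphere 0 1))"
proof -
  have "cis \<in> borel_measurable borel"
    by (intro borel_measurable_continuous_onI continuous_on_cis continuous_on_id)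
  then have "cis \<in> measurable borel (restrict_space borel (sphere 0 1))"
    by (intro measurable_restrict_space2) auto
  moreover have "measurable (uniform_measure lborel {0..2 * pi}) (restrict_space borel (sphere (0::complex) 1))
      = measurable borel (restrict_space borel (sphere 0 1))"
    by (intro measurable_cong_sets) auto
  ultimately show ?thesis by simp
qed

lemma hardy_mean_eq_interval_integral:
  assumes "f holomorphic_on unit_disk" "0 \<le> r" "r < 1" "0 < p"
  shows "hardy_mean p f r =
           1 / (2 * pi) * integral {0..2 * pi} (\<lambda>t. cmod (f (of_real r * cis t)) powr p)"
proof -
  have cf: "continuous_on unit_disk f"
    using assms(1) by (rule holomorphic_on_imp_continuous_on)
  have sub: "(\<lambda>\<xi>. of_real r * \<xi>) ` sphere 0 1 \<subseteq> unit_disk"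
    using assms by (auto simp: norm_mult)
  have c1: "continuous_on (sphere 0 1) (\<lambda>\<xi>. cmod (f (of_real r * \<xi>)) powr p)"
    using assms(4) sub
    by (intro continuous_on_powr' continuous_on_norm continuous_on_compose2[OF cf] continuous_intros) auto
  have c2: "continuous_on {0..2 * pi} (\<lambda>t. cmod (f (of_real r * cis t)) powr p)"
    by (rule continuous_on_compose2[OF c1, of _ cis]) (auto intro!: continuous_intros)
  have m: "(\<lambda>\<xi>. cmod (f (of_real r * \<xi>)) powr p) \<in> borel_measurable (restrict_space borel (sphere 0 1))"
    by (rule borel_measurable_continuous_on_restrict[OF c1])
  have "hardy_mean p f r =
      (LINT t|uniform_measure lborel {0..2 * pi}. cmod (f (of_real r * cis t)) powr p)"
    unfolding hardy_mean_def circle_measure_def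
    by (rule integral_distr[OF cis_measurable_sphere m])
  also have "\<dots> = (LINT t:{0..2 * pi}|lborel. cmod (f (of_real r * cis t)) powr p) / (2 * pi)"
  proof -
    have cc: "continuous_on UNIV (\<lambda>t. cmod (f (of_real r * cis t)) powr p)"
      by (rule continuous_on_compose2[OF c1, of _ cis]) (auto intro!: continuous_intros)
    then have mm: "(\<lambda>t. cmod (f (of_real r * cis t)) powr p) \<in> borel_measurable lborel"
      by (simp add: borel_measurable_continuous_onI)
    have "uniform_measure lborel {0..2 * pi} =
        density lborel (\<lambda>t. ennreal (indicator {0..2 * pi} t / (2 * pi)))"
      unfolding uniform_measure_def
      by (intro density_cong) (auto simp: indicator_def divide_ennreal simp flip: ennreal_1)
    then show ?thesis
      using mm by (simp add: integral_density set_lebesgue_integral_def)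
  qed
  also have "(LINT t:{0..2 * pi}|lborel. cmod (f (of_real r * cis t)) powr p) =
      integral {0..2 * pi} (\<lambda>t. cmod (f (of_real r * cis t)) powr p)"
    by (intro set_borel_integral_eq_integral borel_integrable_atLeastAtMost' c2)
  finally show ?thesis by simp
qed

end

theory Submission
  imports Defs
begin

text \<open>
  Let \<open>F = S\<^sub>g f\<close>. If \<open>\<bar>g\<bar> \<le> 1\<close>, then \<open>\<bar>F'\<bar> \<le> \<bar>f'\<bar>\<close> and \<open>F 0 = 0\<close>, and the estimate
  \<open>\<parallel>F\<parallel>\<^sub>p \<le> C \<parallel>f\<parallel>\<^sub>p\<close> is obtained, for all \<open>p > 0\<close> at once, in the style of Burkholder: with
  \<open>M = \<bar>f\<bar>\<^sup>2 + \<delta>\<close>, \<open>N = \<bar>F\<bar>\<^sup>2 + M\<close> and \<open>s = p / 2\<close> there is a subharmonic combination of \<open>M\<^sup>s\<close>, \<open>N\<^sup>s\<close> and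
  \<open>M N\<^bsup>s-1\<^esup>\<close> which is nonnegative at the origin and at most \<open>K M\<^sup>s - N\<^sup>s / 2\<close> everywhere; integrating
  over circles and letting \<open>\<delta> \<rightarrow> 0\<close> gives the claim. Circle means of subharmonic functions are
  nondecreasing because in the coordinate \<open>w = log z\<close> they are convex functions of \<open>Re w\<close> that stay
  bounded at \<open>-\<infinity>\<close>.

  Conversely, test \<open>S\<^sub>g\<close> on \<open>f\<^sub>a z = (1 - cnj a z)\<^bsup>-2/p\<^esup>\<close>: the growth estimate
  \<open>\<bar>F' a\<bar> \<le> C \<parallel>F\<parallel>\<^sub>p (1 - \<bar>a\<bar>)\<^bsup>-1-1/p\<^esup>\<close> for \<open>F = S\<^sub>g f\<^sub>a\<close> has the same order in \<open>1 - \<bar>a\<bar>\<close> as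
  \<open>\<bar>f\<^sub>a' a\<bar> \<parallel>f\<^sub>a\<parallel>\<^sub>p\<close>, so that \<open>\<bar>g a\<bar>\<close> stays bounded.
\<close>

section \<open>Laplacians and circle means\<close>

text \<open>Differentiation is along the two coordinate lines through \<open>w\<close>, so
  \<open>a\<close> and \<open>b\<close> stand for u_xx and u_yy.\<close>

definition second_partials ::
    "(complex \<Rightarrow> real) \<Rightarrow> (complex \<Rightarrow> complex) \<Rightarrow> (complex \<Rightarrow> real) \<Rightarrow> (complex \<Rightarrow> real) \<Rightarrow> complex \<Rightarrow> bool" where
  "second_partials u d a b w \<longleftrightarrow>
     ((\<lambda>h. u (w + of_real h)) has_real_derivative Re (d w)) (at 0) \<and>
     ((\<lambda>h. u (w + \<i> * of_real h)) has_real_derivative Im (d w)) (at 0) \<and>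
     ((\<lambda>h. Re (d (w + of_real h))) has_real_derivative a w) (at 0) \<and>
     ((\<lambda>h. Im (d (w + \<i> * of_real h))) has_real_derivative b w) (at 0)"

text \<open>The gradient of \<^term>\<open>u\<close> is encoded as the complex number \<open>d = u\<^sub>x + \<i> u\<^sub>y\<close>; \<^term>\<open>L\<close> is the Laplacian.\<close>
definition has_laplacian ::
    "complex set \<Rightarrow> (complex \<Rightarrow> real) \<Rightarrow> (complex \<Rightarrow> complex) \<Rightarrow> (complex \<Rightarrow> real) \<Rightarrow> bool" where
  "has_laplacian S u d L \<longleftrightarrow> continuous_on S u \<and> continuous_on S d \<and>
     (\<exists>a b. continuous_on S a \<and> continuous_on S b \<and>
       (\<forall>w\<in>S. second_partials u d a b w \<and> L w = a w + b w))"

lemma has_laplacianI: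
  assumes "continuous_on S u" "continuous_on S d" "continuous_on S a" "continuous_on S b"
    "\<And>w. w \<in> S \<Longrightarrow> second_partials u d a b w"
    "\<And>w. w \<in> S \<Longrightarrow> L w = a w + b w"
  shows "has_laplacian S u d L"
  using assms unfolding has_laplacian_def by blast

lemma has_laplacianE:
  assumes "has_laplacian S u d L"
  obtains a b where "continuous_on S u" "continuous_on S d" "continuous_on S a" "continuous_on S b"
    "\<And>w. w \<in> S \<Longrightarrow> second_partials u d a b w"
    "\<And>w. w \<in> S \<Longrightarrow> L w = a w + b w"
  using assms unfolding has_laplacian_def by blast

lemma has_laplacian_add:
  assumes "has_laplacian S u d L" "has_laplacian S v e K"
  shows "has_laplacian S (\<lambda>w. u w + v w) (\<lambda>w. d w + e w) (\<lambda>w. L w + K w)"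
proof -
  obtain a b where 1: "continuous_on S u" "continuous_on S d" "continuous_on S a" "continuous_on S b"
      "\<And>w. w \<in> S \<Longrightarrow> second_partials u d a b w" "\<And>w. w \<in> S \<Longrightarrow> L w = a w + b w"
    using assms(1) by (rule has_laplacianE) blast
  obtain a' b' where 2: "continuous_on S v" "continuous_on S e" "continuous_on S a'" "continuous_on S b'"
      "\<And>w. w \<in> S \<Longrightarrow> second_partials v e a' b' w" "\<And>w. w \<in> S \<Longrightarrow> K w = a' w + b' w"
    using assms(2) by (rule has_laplacianE) blast
  show ?thesis
  proof (rule has_laplacianI[where a = "\<lambda>w. a w + a' w" and b = "\<lambda>w. b w + b' w"])
    fix w assume w: "w \<in> S"
    show "second_partials (\<lambda>w. u w + v w) (\<lambda>w. d w + e w) (\<lambda>w. a w + a' w) (\<lambda>w. b w + b' w) w"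
      using 1(5)[OF w] 2(5)[OF w] by (auto simp: second_partials_def intro!: DERIV_add)
  qed (intro continuous_intros 1 2 | simp add: 1 2)+
qed

lemma has_laplacian_cmult:
  assumes "has_laplacian S u d L"
  shows "has_laplacian S (\<lambda>w. c * u w) (\<lambda>w. of_real c * d w) (\<lambda>w. c * L w)"
proof -
  obtain a b where 1: "continuous_on S u" "continuous_on S d" "continuous_on S a" "continuous_on S b"
      "\<And>w. w \<in> S \<Longrightarrow> second_partials u d a b w" "\<And>w. w \<in> S \<Longrightarrow> L w = a w + b w"
    using assms(1) by (rule has_laplacianE) blast
  show ?thesis
  proof (rule has_laplacianI[where a = "\<lambda>w. c * a w" and b = "\<lambda>w. c * b w"])
    fix w assume w: "w \<in> S"
    show "second_partials (\<lambda>w. c * u w) (\<lambda>w. of_real c * d w) (\<lambda>w. c * a w) (\<lambda>w. c * b w) w"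
      using 1(5)[OF w] by (auto simp: second_partials_def intro!: DERIV_cmult)
  qed (intro continuous_intros 1 | simp add: 1 algebra_simps)+
qed

lemma has_laplacian_mult:
  assumes "has_laplacian S u d L" "has_laplacian S v e K"
  shows "has_laplacian S (\<lambda>w. u w * v w) (\<lambda>w. of_real (u w) * e w + of_real (v w) * d w)
           (\<lambda>w. u w * K w + v w * L w + 2 * (d w \<bullet> e w))"
proof -
  obtain a b where 1: "continuous_on S u" "continuous_on S d" "continuous_on S a" "continuous_on S b"
      "\<And>w. w \<in> S \<Longrightarrow> second_partials u d a b w" "\<And>w. w \<in> S \<Longrightarrow> L w = a w + b w"
    using assms(1) by (rule has_laplacianE) blast
  obtain a' b' where 2: "continuous_on S v" "continuous_on S e" "continuous_on S a'" "continuous_on S b'"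
      "\<And>w. w \<in> S \<Longrightarrow> second_partials v e a' b' w" "\<And>w. w \<in> S \<Longrightarrow> K w = a' w + b' w"
    using assms(2) by (rule has_laplacianE) blast
  show ?thesis
  proof (rule has_laplacianI[where a = "\<lambda>w. u w * a' w + v w * a w + 2 * Re (d w) * Re (e w)"
        and b = "\<lambda>w. u w * b' w + v w * b w + 2 * Im (d w) * Im (e w)"])
    fix w assume w: "w \<in> S"
    have *: "((\<lambda>h. u (w + of_real h)) has_real_derivative Re (d w)) (at 0)"
       "((\<lambda>h. u (w + \<i> * of_real h)) has_real_derivative Im (d w)) (at 0)"
       "((\<lambda>h. Re (d (w + of_real h))) has_real_derivative a w) (at 0)"
       "((\<lambda>h. Im (d (w + \<i> * of_real h))) has_real_derivative b w) (at 0)"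
       "((\<lambda>h. v (w + of_real h)) has_real_derivative Re (e w)) (at 0)"
       "((\<lambda>h. v (w + \<i> * of_real h)) has_real_derivative Im (e w)) (at 0)"
       "((\<lambda>h. Re (e (w + of_real h))) has_real_derivative a' w) (at 0)"
       "((\<lambda>h. Im (e (w + \<i> * of_real h))) has_real_derivative b' w) (at 0)"
      using 1(5)[OF w] 2(5)[OF w] by (auto simp: second_partials_def)
    show "second_partials (\<lambda>w. u w * v w) (\<lambda>w. of_real (u w) * e w + of_real (v w) * d w)
        (\<lambda>w. u w * a' w + v w * a w + 2 * Re (d w) * Re (e w))
        (\<lambda>w. u w * b' w + v w * b w + 2 * Im (d w) * Im (e w)) w"
      unfolding second_partials_def
      using DERIV_mult[OF *(1) *(5)] DERIV_mult[OF *(2) *(6)]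
        DERIV_add[OF DERIV_mult[OF *(1) *(7)] DERIV_mult[OF *(5) *(3)]]
        DERIV_add[OF DERIV_mult[OF *(2) *(8)] DERIV_mult[OF *(6) *(4)]]
      by (simp add: algebra_simps)
  qed (intro continuous_intros 1 2 | simp add: 1 2 inner_complex_def algebra_simps)+
qed

lemma has_laplacian_powr:
  assumes "has_laplacian S u d L" "\<And>w. w \<in> S \<Longrightarrow> 0 < u w"
  shows "has_laplacian S (\<lambda>w. u w powr s) (\<lambda>w. of_real (s * u w powr (s - 1)) * d w)
           (\<lambda>w. s * u w powr (s - 1) * L w + s * (s - 1) * u w powr (s - 2) * (cmod (d w))\<^sup>2)"
proof -
  obtain a b where 1: "continuous_on S u" "continuous_on S d" "continuous_on S a" "continuous_on S b"
      "\<And>w. w \<in> S \<Longrightarrow> second_partials u d a b w" "\<And>w. w \<in> S \<Longrightarrow> L w = a w + b w"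
    using assms(1) by (rule has_laplacianE) blast
  have nz: "\<forall>w\<in>S. u w \<noteq> 0"
    using assms(2) by force
  show ?thesis
  proof (rule has_laplacianI[where
        a = "\<lambda>w. s * u w powr (s - 1) * a w + s * (s - 1) * u w powr (s - 2) * (Re (d w))\<^sup>2" and
        b = "\<lambda>w. s * u w powr (s - 1) * b w + s * (s - 1) * u w powr (s - 2) * (Im (d w))\<^sup>2"])
    fix w assume w: "w \<in> S"
    have pos: "0 < u (w + of_real 0)" "0 < u (w + \<i> * of_real 0)"
      using assms(2)[OF w] by auto
    have *: 
       "((\<lambda>h. u (w + of_real h)) has_real_derivative Re (d w)) (at 0)"
       "((\<lambda>h. u (w + \<i> * of_real h)) has_real_derivative Im (d w)) (at 0)"
       "((\<lambda>h. Re (d (w + of_real h))) has_real_derivative a w) (at 0)"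
       "((\<lambda>h. Im (d (w + \<i> * of_real h))) has_real_derivative b w) (at 0)"
      using 1(5)[OF w] by (auto simp: second_partials_def)
    have P: "((\<lambda>h. u (w + of_real h) powr q) has_real_derivative q * u w powr (q - 1) * Re (d w)) (at 0)"
      "((\<lambda>h. u (w + \<i> * of_real h) powr q) has_real_derivative q * u w powr (q - 1) * Im (d w)) (at 0)" for q
      using DERIV_fun_powr[OF *(1) pos(1)] DERIV_fun_powr[OF *(2) pos(2)] by simp_all
    have s2: "s - 1 - 1 = s - 2" by simp
    show "second_partials (\<lambda>w. u w powr s) (\<lambda>w. of_real (s * u w powr (s - 1)) * d w)
        (\<lambda>w. s * u w powr (s - 1) * a w + s * (s - 1) * u w powr (s - 2) * (Re (d w))\<^sup>2)
        (\<lambda>w. s * u w powr (s - 1) * b w + s * (s - 1) * u w powr (s - 2) * (Im (d w))\<^sup>2) w"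
      unfolding second_partials_def
      using P[of s] DERIV_cmult[OF DERIV_mult[OF P(1)[of "s - 1"] *(3)], of s]
        DERIV_cmult[OF DERIV_mult[OF P(2)[of "s - 1"] *(4)], of s]
      by (simp add: s2 algebra_simps power2_eq_square)
  qed (intro continuous_intros 1 nz | simp add: 1 cmod_power2 algebra_simps)+
qed

text \<open>The gradient u_x + \<i> u_y of u = |f|^2 is 2 f times the conjugate of f'. In u_xx and
  u_yy the terms with f'' have opposite signs, since the direction \<i> contributes \<i>^2 = -1;
  only |f'|^2 survives in the sum.\<close>

lemma has_laplacian_norm_square:
  assumes "open S" "\<And>w. w \<in> S \<Longrightarrow> (f has_field_derivative f' w) (at w)"
  shows "has_laplacian S (\<lambda>w. (cmod (f w))\<^sup>2 + c) (\<lambda>w. 2 * f w * cnj (f' w)) (\<lambda>w. 4 * (cmod (f' w))\<^sup>2)"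
proof -
  have hf: "f holomorphic_on S"
    using assms by (meson holomorphic_onI has_field_derivative_at_within field_differentiable_def)
  have "f' holomorphic_on S"
    using holomorphic_deriv[OF hf assms(1)] by (rule holomorphic_transform) (use assms(2) DERIV_imp_deriv in blast)
  then have d2: "(f' has_field_derivative deriv f' w) (at w)" if "w \<in> S" for w
    using assms(1) that by (meson holomorphic_derivI)
  have cont: "continuous_on S f" "continuous_on S f'" "continuous_on S (deriv f')"
    using hf \<open>f' holomorphic_on S\<close> assms(1) by (auto intro!: holomorphic_on_imp_continuous_on holomorphic_deriv)
  \<comment> \<open>By the chain rule \<open>k\<close> has derivative \<open>k' * v\<close> along
    the line through \<open>w\<close> in direction \<open>v\<close>; the directions 1 and \<i>
    supply all partial derivatives used below.\<close>
  have line: "((\<lambda>h. Re (k (w + v * of_real h))) has_real_derivative Re (k' * v)) (at 0)"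
       "((\<lambda>h. Im (k (w + v * of_real h))) has_real_derivative Im (k' * v)) (at 0)"
    if k: "(k has_field_derivative k') (at w)" for k k' and w v :: complex
  proof -
    have "((\<lambda>h. k (w + v * h)) has_field_derivative k' * v) (at (of_real 0))"
      by (rule DERIV_chain2[where g = "\<lambda>h. w + v * h" and f = k]) (use k in \<open>auto intro!: derivative_eq_intros\<close>)
    then have *: "((\<lambda>h. k (w + v * of_real h)) has_vector_derivative k' * v) (at 0)"
      by (rule has_vector_derivative_real_field)
    show "((\<lambda>h. Re (k (w + v * of_real h))) has_real_derivative Re (k' * v)) (at 0)"
       "((\<lambda>h. Im (k (w + v * of_real h))) has_real_derivative Im (k' * v)) (at 0)"
      using bounded_linear.has_vector_derivative[OF bounded_linear_Re *]
        bounded_linear.has_vector_derivative[OF bounded_linear_Im *]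
      by (simp_all add: has_real_derivative_iff_has_vector_derivative)
  qed
  show ?thesis
  proof (rule has_laplacianI[where
      a = "\<lambda>w. 2 * (cmod (f' w))\<^sup>2 + 2 * (Re (f w) * Re (deriv f' w) + Im (f w) * Im (deriv f' w))" and
      b = "\<lambda>w. 2 * (cmod (f' w))\<^sup>2 - 2 * (Re (f w) * Re (deriv f' w) + Im (f w) * Im (deriv f' w))"])
    fix w assume w: "w \<in> S"
    note l = line[OF assms(2)[OF w]] line[OF d2[OF w]]
    note 1 = l[of 1, unfolded mult_1 mult_1_right]
    note i = l[of \<i>]
    show "second_partials (\<lambda>w. (cmod (f w))\<^sup>2 + c) (\<lambda>w. 2 * f w * cnj (f' w))
      (\<lambda>w. 2 * (cmod (f' w))\<^sup>2 + 2 * (Re (f w) * Re (deriv f' w) + Im (f w) * Im (deriv f' w)))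
      (\<lambda>w. 2 * (cmod (f' w))\<^sup>2 - 2 * (Re (f w) * Re (deriv f' w) + Im (f w) * Im (deriv f' w))) w"
      unfolding second_partials_def
    proof (intro conjI)
      show "((\<lambda>h. (cmod (f (w + of_real h)))\<^sup>2 + c) has_real_derivative Re (2 * f w * cnj (f' w))) (at 0)"
        unfolding cmod_power2 by (rule derivative_eq_intros 1 | simp)+
      show "((\<lambda>h. (cmod (f (w + \<i> * of_real h)))\<^sup>2 + c) has_real_derivative Im (2 * f w * cnj (f' w))) (at 0)"
        unfolding cmod_power2 by (rule derivative_eq_intros i | simp)+
      show "((\<lambda>h. Re (2 * f (w + of_real h) * cnj (f' (w + of_real h)))) has_real_derivative
          2 * (cmod (f' w))\<^sup>2 + 2 * (Re (f w) * Re (deriv f' w) + Im (f w) * Im (deriv f' w))) (at 0)"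
        unfolding cmod_power2
        using DERIV_cmult[OF DERIV_add[OF DERIV_mult[OF 1(1) 1(3)] DERIV_mult[OF 1(2) 1(4)]], of 2]
        by (simp add: power2_eq_square algebra_simps)
      show "((\<lambda>h. Im (2 * f (w + \<i> * of_real h) * cnj (f' (w + \<i> * of_real h)))) has_real_derivative
          2 * (cmod (f' w))\<^sup>2 - 2 * (Re (f w) * Re (deriv f' w) + Im (f w) * Im (deriv f' w))) (at 0)"
        unfolding cmod_power2
        using DERIV_cmult[OF DERIV_diff[OF DERIV_mult[OF i(2) i(3)] DERIV_mult[OF i(1) i(4)]], of 2]
        by (simp add: power2_eq_square algebra_simps)
    qed
  qed (intro continuous_intros cont | simp)+
qed

section \<open>Convexity in the logarithm of the radius and monotonicity of circle means\<close>

text \<open>If \<open>m\<close> dropped between \<open>x\<close> and \<open>y\<close>, convexity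
  would force it to rise at least linearly towards -\<infinity>, against the bound \<open>B\<close>
  there.\<close>

lemma convex_bounded_at_bot_imp_mono:
  fixes m :: "real \<Rightarrow> real"
  assumes conv: "convex_on {..<c} m" and bd: "\<And>x. x < c' \<Longrightarrow> m x \<le> B"
    and xy: "x \<le> y" "y < c"
  shows "m x \<le> m y"
proof (rule ccontr)
  assume "\<not> m x \<le> m y"
  then have lt: "m y < m x" by simp
  then have "x < y" using xy by (cases "x = y") auto
  \<comment> \<open>\<open>k\<close> is the signed distance to the left of \<open>x\<close> at which
    the chord through the graph points over \<open>x\<close> and \<open>y\<close> reaches height
    \<open>B\<close>. The point \<open>z\<close> lies beyond it and also left of \<open>c'\<close>,
    so \<open>m z\<close> would have to exceed \<open>B\<close>.\<close>
  define k where "k = (y - x) * (B - m x) / (m x - m y)"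
  define z where "z = min (c' - 1) (x - 1 - \<bar>k\<bar>)"
  have z: "z < x" "z < c'" "x - z > k" by (auto simp: z_def)
  define \<theta> where "\<theta> = (x - z) / (y - z)"
  have \<theta>: "0 \<le> \<theta>" "\<theta> \<le> 1" "\<theta> * (y - z) = x - z"
    using z \<open>x < y\<close> by (auto simp: \<theta>_def)
  then have x_eq: "x = (1 - \<theta>) * z + \<theta> * y"
    by (simp add: algebra_simps)
  have "m ((1 - \<theta>) *\<^sub>R z + \<theta> *\<^sub>R y) \<le> (1 - \<theta>) * m z + \<theta> * m y"
    using conv \<theta> z xy \<open>x < y\<close> by (intro convex_onD) auto
  also have "\<dots> \<le> (1 - \<theta>) * B + \<theta> * m y"
    using bd[OF z(2)] \<theta> by (intro add_mono mult_left_mono) auto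
  finally have "m x \<le> (1 - \<theta>) * B + \<theta> * m y"
    using x_eq by simp
  then have "\<theta> * (m x - m y) \<le> (1 - \<theta>) * (B - m x)"
    by (simp add: algebra_simps)
  then have "(y - z) * (\<theta> * (m x - m y)) \<le> (y - z) * ((1 - \<theta>) * (B - m x))"
    using z \<open>x < y\<close> by (intro mult_left_mono) auto
  moreover have "(y - z) * \<theta> = x - z" "(y - z) * (1 - \<theta>) = y - x"
    using \<theta>(3) by (auto simp: algebra_simps)
  ultimately have "(x - z) * (m x - m y) \<le> (y - x) * (B - m x)"
    by (metis mult.assoc)
  then have "x - z \<le> k"
    using lt by (simp add: k_def pos_le_divide_eq)
  with z show False by simp
qed

text \<open>Differentiating twice under the integral sign gives the integral of u_xx = L - u_yy. The
  integral of u_yy over a full period is the increment of u_y, which is zero, so the second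
  derivative is the integral of \<open>L\<close>.\<close>

lemma convex_on_vertical_integral:
  assumes lap: "has_laplacian {w. Re w < 0} u d L"
    and nonneg: "\<And>w. Re w < 0 \<Longrightarrow> 0 \<le> L w"
    and per: "\<And>w. Re w < 0 \<Longrightarrow> u (w + 2 * pi * \<i>) = u w"
  shows "convex_on {..<0} (\<lambda>x. integral {0..2*pi} (\<lambda>t. u (Complex x t)))"
proof -
  let ?S = "{w. Re w < 0}"
  obtain a b where c: "continuous_on ?S u" "continuous_on ?S d" "continuous_on ?S a" "continuous_on ?S b"
      and sp: "\<And>w. w \<in> ?S \<Longrightarrow> second_partials u d a b w" and Lab: "\<And>w. w \<in> ?S \<Longrightarrow> L w = a w + b w"
    using lap by (rule has_laplacianE) blast
  have C: "continuous_on ({..<0} \<times> cbox 0 (2*pi)) (\<lambda>(x, t). k (Complex x t))"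
    if "continuous_on ?S k" for k :: "complex \<Rightarrow> real"
    unfolding case_prod_beta Complex_eq
    by (rule continuous_on_compose2[OF that]) (auto intro!: continuous_intros)
  have C1: "continuous_on {0..2*pi} (\<lambda>t. k (Complex x t))"
    if "continuous_on ?S k" "x < 0" for k :: "complex \<Rightarrow> real" and x
    unfolding Complex_eq
    by (rule continuous_on_compose2[OF that(1)]) (use that(2) in \<open>auto intro!: continuous_intros\<close>)
  have int: "(\<lambda>t. k (Complex x t)) integrable_on {0..2*pi}"
    if "continuous_on ?S k" "x < 0" for k :: "complex \<Rightarrow> real" and x
    by (intro integrable_continuous_interval C1 that)
  have Dx: "((\<lambda>x. integral {0..2*pi} (\<lambda>t. k (Complex x t))) has_real_derivative
        integral {0..2*pi} (\<lambda>t. k' (Complex x t))) (at x)"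
    if k: "continuous_on ?S k" "continuous_on ?S k'" "x < 0"
      "\<And>w. w \<in> ?S \<Longrightarrow> ((\<lambda>h. k (w + of_real h)) has_real_derivative k' w) (at 0)" for k k' x
  proof -
    have "((\<lambda>x. k (Complex x t)) has_real_derivative k' (Complex x t)) (at x within {..<0})"
      if "x < 0" for x t
    proof -
      have "((\<lambda>h. k (Complex (h + x) t)) has_real_derivative k' (Complex x t)) (at 0)"
        using k(4)[of "Complex x t"] that by (simp add: Complex_eq algebra_simps)
      then have "((\<lambda>x. k (Complex x t)) has_real_derivative k' (Complex x t)) (at x)"
        using DERIV_shift[of "\<lambda>x. k (Complex x t)" _ 0 x] by simp
      then show ?thesis by (rule has_field_derivative_at_within)
    qed
    from leibniz_rule_field_derivative[OF this int[OF k(1), folded cbox_interval] C[OF k(2)], of x] k(3)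
    have "((\<lambda>x. integral (cbox 0 (2*pi)) (\<lambda>t. k (Complex x t))) has_real_derivative
        integral (cbox 0 (2*pi)) (\<lambda>t. k' (Complex x t))) (at x within {..<0})"
      by simp
    moreover have "at x within {..<0} = at x"
      by (rule at_within_open) (use k(3) in auto)
    ultimately show ?thesis by simp
  qed
  have cRe: "continuous_on ?S (\<lambda>w. Re (d w))"
    by (intro continuous_intros c)
  show ?thesis
  proof (rule f''_ge0_imp_convex)
    fix x :: real assume "x \<in> {..<0}"
    then have x: "x < 0" by simp
    show "((\<lambda>x. integral {0..2*pi} (\<lambda>t. u (Complex x t))) has_real_derivative
        integral {0..2*pi} (\<lambda>t. Re (d (Complex x t)))) (at x)"
      by (rule Dx) (use c cRe x sp in \<open>simp_all add: second_partials_def\<close>)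
    show "((\<lambda>x. integral {0..2*pi} (\<lambda>t. Re (d (Complex x t)))) has_real_derivative
        integral {0..2*pi} (\<lambda>t. a (Complex x t))) (at x)"
      by (rule Dx[of "\<lambda>w. Re (d w)"]) (use c cRe x sp in \<open>simp_all add: second_partials_def\<close>)
    have "((\<lambda>h. u (Complex x 0 + \<i> * of_real h)) has_real_derivative Im (d (Complex x 0))) (at 0)"
      "((\<lambda>h. u (Complex x (2*pi) + \<i> * of_real h)) has_real_derivative Im (d (Complex x (2*pi)))) (at 0)"
      using sp[of "Complex x 0"] sp[of "Complex x (2*pi)"] x by (auto simp: second_partials_def)
    \<comment> \<open>Periodicity of \<open>u\<close> passes to its vertical derivative by
      uniqueness of derivatives.\<close>
    moreover have "u (Complex x (2*pi) + \<i> * of_real h) = u (Complex x 0 + \<i> * of_real h)" for h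
      using per[of "Complex x 0 + \<i> * of_real h"] x by (simp add: Complex_eq algebra_simps)
    ultimately have dper: "Im (d (Complex x (2*pi))) = Im (d (Complex x 0))"
      using DERIV_unique by auto
    have "((\<lambda>t. Im (d (Complex x t))) has_vector_derivative b (Complex x t)) (at t within {0..2*pi})" for t
    proof -
      have "((\<lambda>h. Im (d (Complex x (h + t)))) has_real_derivative b (Complex x t)) (at 0)"
        using sp[of "Complex x t"] x by (simp add: Complex_eq algebra_simps second_partials_def)
      then have "((\<lambda>t. Im (d (Complex x t))) has_real_derivative b (Complex x t)) (at t)"
        using DERIV_shift[of "\<lambda>t. Im (d (Complex x t))" _ 0 t] by simp
      then show ?thesis
        by (simp add: has_real_derivative_iff_has_vector_derivative has_vector_derivative_at_within)
    qed
    then have "((\<lambda>t. b (Complex x t)) has_integral Im (d (Complex x (2*pi))) - Im (d (Complex x 0))) {0..2*pi}"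
      by (intro fundamental_theorem_of_calculus) auto
    then have ib: "((\<lambda>t. b (Complex x t)) has_integral 0) {0..2*pi}"
      by (simp add: dper)
    have "integral {0..2*pi} (\<lambda>t. a (Complex x t) + b (Complex x t)) =
        integral {0..2*pi} (\<lambda>t. a (Complex x t)) + 0"
      using int[OF c(3) x] ib by (subst integral_add) (auto simp: has_integral_integrable integral_unique)
    moreover have "0 \<le> integral {0..2*pi} (\<lambda>t. a (Complex x t) + b (Complex x t))"
      using nonneg Lab x by (intro integral_nonneg integrable_add int c) (metis mem_Collect_eq complex.sel(1))+
    ultimately show "0 \<le> integral {0..2*pi} (\<lambda>t. a (Complex x t))" by simp
  qed simp
qed

text \<open>Unnormalised: \<open>2 * pi\<close> times the circle mean, and
  \<open>2 * pi * U 0\<close> at radius 0.\<close>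

definition circle_integral :: "(complex \<Rightarrow> real) \<Rightarrow> real \<Rightarrow> real" where
  "circle_integral U r = integral {0..2*pi} (\<lambda>t. U (of_real r * cis t))"

lemma continuous_on_circle:
  assumes "continuous_on (ball 0 R) U" "0 \<le> r" "r < R"
  shows "continuous_on T (\<lambda>t. U (of_real r * cis t))"
  by (rule continuous_on_compose2[OF assms(1)]) (use assms in \<open>auto intro!: continuous_intros simp: norm_mult\<close>)

lemma continuous_on_circle_integral:
  assumes "continuous_on unit_disk U"
  shows "continuous_on {0..<1} (circle_integral U)"
proof -
  have "continuous_on ({0..<1} \<times> cbox 0 (2*pi)) (\<lambda>(r, t). U (of_real r * cis t))"
    unfolding case_prod_beta
    by (rule continuous_on_compose2[OF assms]) (auto intro!: continuous_intros simp: norm_mult)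
  then show ?thesis
    unfolding circle_integral_def[abs_def] by (metis integral_continuous_on_param cbox_interval)
qed

text \<open>The map exp carries a vertical segment of length 2 pi onto a circle, so the circle
  integral over radius \<open>exp x\<close> is convex in \<open>x\<close>. It stays bounded as
  \<open>x\<close> tends to -\<infinity> because the circle integral is continuous on the compact
  interval from 0 to 1/2.\<close>

lemma circle_integral_mono_radius:
  assumes cont: "continuous_on unit_disk U"
    and lap: "has_laplacian {w. Re w < 0} (\<lambda>w. U (exp w)) d L"
    and nonneg: "\<And>w. Re w < 0 \<Longrightarrow> 0 \<le> L w"
    and r: "0 \<le> r" "r \<le> r'" "r' < 1"
  shows "circle_integral U r \<le> circle_integral U r'"
proof -
  let ?A = "circle_integral U"
  define m where "m x = integral {0..2*pi} (\<lambda>t. U (exp (Complex x t)))" for x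
  have m: "m x = ?A (exp x)" for x
    by (simp add: m_def circle_integral_def exp_eq_polar)
  have conv: "convex_on {..<0} m"
    unfolding m_def
    by (rule convex_on_vertical_integral[OF lap nonneg]) (auto simp: exp_add exp_two_pi_i mult.commute)
  have contA: "continuous_on {0..<1} ?A"
    by (rule continuous_on_circle_integral[OF cont])
  have "continuous_on {0..1/2} ?A"
    by (rule continuous_on_subset[OF contA]) auto
  then have "bounded (?A ` {0..1/2})"
    by (intro compact_imp_bounded compact_continuous_image) auto
  then obtain B where B: "\<And>\<rho>. \<rho> \<in> {0..1/2} \<Longrightarrow> \<bar>?A \<rho>\<bar> \<le> B"
    unfolding bounded_iff real_norm_def by (metis imageI)
  have bd: "m x \<le> B" if "x < ln (1/2)" for x
  proof -
    have "exp x < exp (ln (1/2))" using that by (subst exp_less_cancel_iff)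
    then show ?thesis using B[of "exp x"] by (simp add: m)
  qed
  have pos: "?A \<rho> \<le> ?A r'" if "0 < \<rho>" "\<rho> \<le> r'" for \<rho>
  proof -
    have "m (ln \<rho>) \<le> m (ln r')"
      by (rule convex_bounded_at_bot_imp_mono[OF conv bd]) (use that r in auto)
    then show ?thesis
      using that by (simp add: m)
  qed
  show ?thesis
  proof (cases "r = 0")
    case True
    show ?thesis
    proof (cases "r' = 0")
      case False
      \<comment> \<open>Radius 0 is not of the form \<open>exp x\<close>; the inequality for small
        positive radii is carried to it by continuity from the right.\<close>
      then have r': "0 < r'" using r by simp
      have "continuous_on {0..1/2} ?A"
        by (rule continuous_on_subset[OF contA]) auto
      then have "(?A \<longlongrightarrow> ?A 0) (at 0 within {0..1/2})"
        by (simp add: continuous_on_def)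
      then have "(?A \<longlongrightarrow> ?A 0) (at_right 0)"
        by (simp add: at_within_Icc_at_right)
      moreover have "eventually (\<lambda>\<rho>. ?A \<rho> \<le> ?A r') (at_right 0)"
        using eventually_at_right_less eventually_at_rightI[of 0 r' "\<lambda>\<rho>. ?A \<rho> \<le> ?A r'"] pos r' by force
      ultimately show ?thesis
        using tendsto_upperbound[of ?A "?A 0" "at_right 0" "?A r'"] True by simp
    qed (use True in simp)
  qed (use pos r in auto)
qed

section \<open>Differential subordination\<close>

text \<open>Here \<open>l\<close> is the Laplacian of \<open>u\<close>, \<open>k\<close> its squared
  gradient, and the expression estimated is the Laplacian of \<open>u powr s\<close>. With j = k / u
  in [0, l] it equals s u^(s-1) (l + (s-1) j), and the last factor lies between l and s l.\<close>

lemma powr_laplacian_bounds: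
  fixes u l k s :: real
  assumes "0 < u" "0 < s" "0 \<le> k" "k \<le> u * l"
  shows "s * min 1 s * u powr (s - 1) * l \<le> s * u powr (s - 1) * l + s * (s - 1) * u powr (s - 2) * k"
    and "s * u powr (s - 1) * l + s * (s - 1) * u powr (s - 2) * k \<le> s * max 1 s * u powr (s - 1) * l"
proof -
  define j where "j = k / u"
  have j: "0 \<le> j" "j \<le> l"
    using assms by (auto simp: j_def divide_le_eq mult.commute)
  have "u powr (s - 2) * u = u powr (s - 1)"
    using assms(1) powr_mult_base[of u "s - 2"] by (simp add: mult.commute)
  then have "u powr (s - 2) * k = u powr (s - 1) * j"
    using assms(1) by (simp add: j_def field_simps)
  then have eq: "s * u powr (s - 1) * l + s * (s - 1) * u powr (s - 2) * k =
      s * u powr (s - 1) * (l + (s - 1) * j)"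
    by (simp only: mult.assoc) (simp add: algebra_simps)
  have "min 1 s * l \<le> l + (s - 1) * j"
  proof (cases "s \<le> 1")
    case True
    then have "(1 - s) * j \<le> (1 - s) * l" using j by (intro mult_left_mono) auto
    then show ?thesis using True by (simp add: algebra_simps min_def)
  next
    case False
    then have "0 \<le> (s - 1) * j" using j by simp
    then show ?thesis using False by (simp add: min_def)
  qed
  then have "s * u powr (s - 1) * (min 1 s * l) \<le> s * u powr (s - 1) * (l + (s - 1) * j)"
    using assms by (intro mult_left_mono) auto
  then show "s * min 1 s * u powr (s - 1) * l \<le> s * u powr (s - 1) * l + s * (s - 1) * u powr (s - 2) * k"
    unfolding eq by (simp add: algebra_simps)
  have "l + (s - 1) * j \<le> max 1 s * l"
  proof (cases "s \<le> 1")
    case True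
    then have "0 \<le> (1 - s) * j" using j by simp
    then show ?thesis using True by (simp add: algebra_simps max_def)
  next
    case False
    then have "(s - 1) * j \<le> (s - 1) * l" using j by (intro mult_left_mono) auto
    then show ?thesis using False by (simp add: algebra_simps max_def)
  qed
  then have "s * u powr (s - 1) * (l + (s - 1) * j) \<le> s * u powr (s - 1) * (max 1 s * l)"
    using assms by (intro mult_left_mono) auto
  then show "s * u powr (s - 1) * l + s * (s - 1) * u powr (s - 2) * k \<le> s * max 1 s * u powr (s - 1) * l"
    unfolding eq by (simp add: algebra_simps)
qed

lemma powr_scaled_mono:
  fixes N a M q :: real
  assumes "0 < N" "N \<le> a * M" "0 \<le> a" "0 < M" "0 \<le> q"
  shows "N powr q \<le> a powr q * M powr q"
  using powr_mono2[of q N "a * M"] assms by (simp add: powr_mult)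

text \<open>\<open>M\<close> stands for \<open>\<bar>f\<bar>\<^sup>2 + \<delta>\<close> and \<open>N\<close> for \<open>\<bar>F\<bar>\<^sup>2 + \<bar>f\<bar>\<^sup>2 + \<delta>\<close>, where \<open>\<bar>F'\<bar> \<le> \<bar>f'\<bar>\<close>; the shift by \<open>\<delta> > 0\<close>
  only serves to keep the powers smooth at common zeros.\<close>
definition majorant :: "real \<Rightarrow> real \<Rightarrow> real \<Rightarrow> real" where
  "majorant s M N =
     (if s \<le> 1 then (2 / s) * M powr s + (-1) * N powr s
      else (4 * s\<^sup>2) * (M * N powr (s - 1)) +
        (s * (12 * (s - 1) * (36 * (s - 1)\<^sup>2) powr (s - 1))) * M powr s + (-1) * N powr s)"

text \<open>This is the situation at the origin, where F 0 = 0 makes \<open>N\<close> equal to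
  \<open>M\<close>. The leading coefficient, 2 / s for s \<le> 1 and 4 s^2 for s > 1, is at least 1
  and outweighs the term -N^s.\<close>

lemma majorant_diagonal_nonneg:
  assumes "0 < s" "0 < M"
  shows "0 \<le> majorant s M M"
proof (cases "s \<le> 1")
  case True
  have "1 * M powr s \<le> (2 / s) * M powr s"
    using True assms by (intro mult_right_mono) (auto simp: field_simps)
  then show ?thesis using True by (simp add: majorant_def)
next
  case False
  have "M * M powr (s - 1) = M powr s"
    using assms powr_mult_base[of M "s - 1"] by simp
  moreover have "1 * M powr s \<le> (4 * s\<^sup>2) * M powr s"
    using False mult_mono[of 1 s 1 s] by (intro mult_right_mono) (auto simp: power2_eq_square)
  moreover have "0 \<le> (s * (12 * (s - 1) * (36 * (s - 1)\<^sup>2) powr (s - 1))) * M powr s"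
    using False by simp
  ultimately show ?thesis
    using False unfolding majorant_def by (simp only: if_False)
qed

text \<open>Only the mixed term M N^(s-1) needs an argument: it is at most a small multiple of N^s
  plus a large multiple of M^s, in the manner of Young's inequality.\<close>

lemma majorant_upper_bound:
  assumes "0 < s"
  obtains K where "0 \<le> K" "\<And>M N. 0 < M \<Longrightarrow> M \<le> N \<Longrightarrow> majorant s M N \<le> K * M powr s - N powr s / 2"
proof (cases "s \<le> 1")
  case True
  show ?thesis
    by (rule that[of "2 / s"]) (use True assms in \<open>auto simp: majorant_def\<close>)
next
  case False
  define A where "A = s * (12 * (s - 1) * (36 * (s - 1)\<^sup>2) powr (s - 1))"
  have A: "0 \<le> A" using False by (simp add: A_def)
  show ?thesis
  proof (rule that[of "4 * s\<^sup>2 * (8 * s\<^sup>2) powr s + A"])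
    fix M N :: real assume MN: "0 < M" "M \<le> N"
    have base: "N * N powr (s - 1) = N powr s"
      using MN powr_mult_base[of N "s - 1"] by simp
    have "4 * s\<^sup>2 * (M * N powr (s - 1)) \<le> N powr s / 2 + 4 * s\<^sup>2 * (8 * s\<^sup>2) powr s * M powr s"
    \<comment> \<open>Above the threshold the mixed term with its coefficient 4 s^2 is at most half
      of N^s; below it \<open>N\<close> is comparable to \<open>M\<close>, and N^s is bounded by a
      multiple of M^s.\<close>
    proof (cases "8 * s\<^sup>2 * M \<le> N")
      case True
      then have "8 * s\<^sup>2 * M * N powr (s - 1) \<le> N * N powr (s - 1)"
        by (intro mult_right_mono) auto
      moreover have "0 \<le> 4 * s\<^sup>2 * (8 * s\<^sup>2) powr s * M powr s" by simp
      ultimately show ?thesis using base by (simp only: mult.assoc)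
    next
      case large: False
      have "M * N powr (s - 1) \<le> N * N powr (s - 1)"
        using MN by (intro mult_right_mono) auto
      also have "\<dots> \<le> (8 * s\<^sup>2) powr s * M powr s"
        unfolding base using large MN assms by (intro powr_scaled_mono) auto
      finally have "4 * s\<^sup>2 * (M * N powr (s - 1)) \<le> 4 * s\<^sup>2 * ((8 * s\<^sup>2) powr s * M powr s)"
        by (intro mult_left_mono) auto
      then show ?thesis by (simp add: mult.assoc add_increasing)
    qed
    then show "majorant s M N \<le> (4 * s\<^sup>2 * (8 * s\<^sup>2) powr s + A) * M powr s - N powr s / 2"
      using False by (simp add: majorant_def A_def distrib_right)
  qed (use A in simp)
qed

lemma continuous_on_majorant:
  assumes "continuous_on S M" "continuous_on S N" "\<And>w. w \<in> S \<Longrightarrow> 0 < M w" "\<And>w. w \<in> S \<Longrightarrow> 0 < N w" "0 < s"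
  shows "continuous_on S (\<lambda>w. majorant s (M w) (N w))"
proof -
  have "\<forall>w\<in>S. M w \<noteq> 0" "\<forall>w\<in>S. N w \<noteq> 0" using assms by force+
  then show ?thesis
    unfolding majorant_def using assms(1,2,5)
    by (cases "s \<le> 1") (auto intro!: continuous_intros)
qed

text \<open>This controls the gradient term in the Laplacian of M N^q, with c = |f'|^2 and e =
  |F'|^2. The loss 2 c N^q is half of the gain 4 c N^q coming from N^q times the Laplacian of M; the
  loss in c M^q is to be paid for by the Laplacian of M^(q+1).\<close>

lemma majorant_cross_term:
  fixes gM gN :: complex and M N c e q :: real
  assumes MN: "0 < M" "M \<le> N" and q: "0 < q" and ce: "0 \<le> e" "e \<le> c"
    and gM: "(cmod gM)\<^sup>2 \<le> M * (4 * c)" and gN: "(cmod gN)\<^sup>2 \<le> N * (4 * e + 4 * c)"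
  shows "- (2 * c * N powr q + c * (12 * q * (36 * q\<^sup>2) powr q) * M powr q)
           \<le> 2 * (gM \<bullet> (of_real (q * N powr (q - 1)) * gN))"
proof -
  have "(cmod gM * cmod gN)\<^sup>2 \<le> (M * (4 * c)) * (N * (8 * c))"
  proof -
    have "(cmod gN)\<^sup>2 \<le> N * (8 * c)"
      using MN ce by (intro order_trans[OF gN] mult_left_mono) auto
    then show ?thesis
      unfolding power_mult_distrib using gM MN ce by (intro mult_mono) auto
  qed
  \<comment> \<open>The constant 6 comes from 4 * 8 = 32 \<le> 36.\<close>
  also have "\<dots> \<le> (6 * c * sqrt (M * N))\<^sup>2"
    using MN ce by (auto simp: power_mult_distrib power2_eq_square algebra_simps intro!: mult_left_mono)
  finally have prod: "cmod gM * cmod gN \<le> 6 * c * sqrt (M * N)"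
    by (rule power2_le_imp_le) (use MN ce in auto)
  have base: "N * N powr (q - 1) = N powr q"
    using MN powr_mult_base[of N "q - 1"] by simp
  have key: "12 * q * (N powr (q - 1) * sqrt (M * N)) \<le>
      2 * N powr q + 12 * q * (36 * q\<^sup>2) powr q * M powr q"
  \<comment> \<open>Above this threshold 6 q sqrt (M N) is at most N, so the left side is at most 2
    N^q; below it sqrt (M N) \<le> N and N^q is bounded by a multiple of M^q.\<close>
  proof (cases "36 * q\<^sup>2 * M \<le> N")
    case True
    have "(6 * q * sqrt (M * N))\<^sup>2 = 36 * q\<^sup>2 * M * N"
      using MN by (simp add: power_mult_distrib)
    also have "\<dots> \<le> N\<^sup>2"
      using True MN by (simp add: power2_eq_square)
    finally have "(6 * q * sqrt (M * N))\<^sup>2 \<le> N\<^sup>2" .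
    then have "6 * q * sqrt (M * N) \<le> N"
      by (rule power2_le_imp_le) (use MN in auto)
    then have "N powr (q - 1) * (6 * q * sqrt (M * N)) \<le> N powr (q - 1) * N"
      by (intro mult_left_mono) auto
    then have "12 * q * (N powr (q - 1) * sqrt (M * N)) \<le> 2 * N powr q"
      using base by (simp add: algebra_simps)
    moreover have "0 \<le> 12 * q * (36 * q\<^sup>2) powr q * M powr q"
      using q by simp
    ultimately show ?thesis by linarith
  next
    case False
    have "(sqrt (M * N))\<^sup>2 \<le> N\<^sup>2"
      using MN by (simp add: power2_eq_square)
    then have "sqrt (M * N) \<le> N"
      by (rule power2_le_imp_le) (use MN in auto)
    then have "N powr (q - 1) * sqrt (M * N) \<le> N powr (q - 1) * N"
      by (intro mult_left_mono) auto
    also have "\<dots> = N powr q"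
      using base by (simp add: mult.commute)
    also have "\<dots> \<le> (36 * q\<^sup>2) powr q * M powr q"
      using False MN q by (intro powr_scaled_mono) auto
    finally have "12 * q * (N powr (q - 1) * sqrt (M * N)) \<le> 12 * q * ((36 * q\<^sup>2) powr q * M powr q)"
      using q by (intro mult_left_mono) auto
    moreover have "0 \<le> 2 * N powr q" by simp
    ultimately show ?thesis by (simp only: mult.assoc)
  qed
  have "\<bar>gM \<bullet> (of_real (q * N powr (q - 1)) * gN)\<bar> \<le> cmod gM * cmod (of_real (q * N powr (q - 1)) * gN)"
    by (rule Cauchy_Schwarz_ineq2)
  also have "\<dots> = q * N powr (q - 1) * (cmod gM * cmod gN)"
    using q by (simp add: norm_mult)
  also have "\<dots> \<le> q * N powr (q - 1) * (6 * c * sqrt (M * N))"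
    using q prod by (intro mult_left_mono) auto
  finally have "2 * \<bar>gM \<bullet> (of_real (q * N powr (q - 1)) * gN)\<bar> \<le> c * (12 * q * (N powr (q - 1) * sqrt (M * N)))"
    by (simp add: algebra_simps)
  also have "\<dots> \<le> c * (2 * N powr q + 12 * q * (36 * q\<^sup>2) powr q * M powr q)"
    using key ce by (intro mult_left_mono) auto
  finally show ?thesis by (simp add: algebra_simps abs_if split: if_splits)
qed

text \<open>With c = |f'|^2, the Laplacian of N^s is at most 8 s max(1, s) c N^(s-1), because |F'|
  \<le> |f'|. The coefficients in \<open>majorant\<close> are chosen so that the Laplacians of the
  other terms cover exactly this loss.\<close>

lemma majorant_subharmonic:
  assumes S: "open S" and s: "0 < s" and \<delta>: "0 < \<delta>"
    and f: "\<And>w. w \<in> S \<Longrightarrow> (f has_field_derivative f' w) (at w)"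
    and F: "\<And>w. w \<in> S \<Longrightarrow> (F has_field_derivative F' w) (at w)"
    and sub: "\<And>w. w \<in> S \<Longrightarrow> cmod (F' w) \<le> cmod (f' w)"
  obtains d L where
    "has_laplacian S (\<lambda>w. majorant s ((cmod (f w))\<^sup>2 + \<delta>) ((cmod (F w))\<^sup>2 + ((cmod (f w))\<^sup>2 + \<delta>))) d L"
    "\<And>w. w \<in> S \<Longrightarrow> 0 \<le> L w"
proof -
  define M where "M w = (cmod (f w))\<^sup>2 + \<delta>" for w
  define gM where "gM w = 2 * f w * cnj (f' w)" for w
  define N where "N w = (cmod (F w))\<^sup>2 + M w" for w
  define gN where "gN w = 2 * F w * cnj (F' w) + gM w" for w
  define c where "c w = (cmod (f' w))\<^sup>2" for w
  define e where "e w = (cmod (F' w))\<^sup>2" for w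
  have lapM: "has_laplacian S M gM (\<lambda>w. 4 * c w)"
    unfolding M_def gM_def c_def by (rule has_laplacian_norm_square[OF S f])
  have "has_laplacian S (\<lambda>w. (cmod (F w))\<^sup>2 + 0) (\<lambda>w. 2 * F w * cnj (F' w)) (\<lambda>w. 4 * e w)"
    unfolding e_def by (rule has_laplacian_norm_square[OF S F])
  from has_laplacian_add[OF this lapM] have lapN: "has_laplacian S N gN (\<lambda>w. 4 * e w + 4 * c w)"
    unfolding N_def gN_def by simp
  have pos: "0 < M w" "M w \<le> N w" "0 < N w" for w
    using \<delta> by (auto simp: M_def N_def add_nonneg_pos)
  have ce: "0 \<le> e w" "0 \<le> c w" for w
    by (auto simp: c_def e_def)
  have ec: "e w \<le> c w" if "w \<in> S" for w
    using sub[OF that] by (simp add: c_def e_def)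
  have gM: "(cmod (gM w))\<^sup>2 \<le> M w * (4 * c w)" for w
    using \<delta> by (auto simp: gM_def M_def c_def norm_mult power_mult_distrib algebra_simps)
  have gN: "(cmod (gN w))\<^sup>2 \<le> N w * (4 * e w + 4 * c w)" for w
  proof -
    \<comment> \<open>Cauchy-Schwarz for the vectors (|F|, |f|) and (|F'|, |f'|) gives the gradient
      bound for \<open>N\<close> that \<open>powr_laplacian_bounds\<close> requires.\<close>
    have CS: "(x1 * y1 + x2 * y2)\<^sup>2 \<le> (x1\<^sup>2 + x2\<^sup>2) * (y1\<^sup>2 + y2\<^sup>2)" for x1 x2 y1 y2 :: real
      using zero_le_power2[of "x1 * y2 - x2 * y1"] by (simp add: power2_eq_square algebra_simps)
    have "cmod (gN w) \<le> 2 * (cmod (F w) * cmod (F' w) + cmod (f w) * cmod (f' w))"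
      unfolding gN_def gM_def by (rule order_trans[OF norm_triangle_ineq]) (simp add: norm_mult)
    then have "(cmod (gN w))\<^sup>2 \<le> (2 * (cmod (F w) * cmod (F' w) + cmod (f w) * cmod (f' w)))\<^sup>2"
      by (intro power_mono) auto
    also have "\<dots> \<le> 4 * (((cmod (F w))\<^sup>2 + (cmod (f w))\<^sup>2) * (e w + c w))"
      unfolding power_mult_distrib[of "2::real"] c_def e_def using mult_left_mono[OF CS, of 4] by simp
    also have "\<dots> \<le> 4 * (N w * (e w + c w))"
      using \<delta> ce by (intro mult_left_mono mult_right_mono) (auto simp: N_def M_def)
    finally show ?thesis by (simp add: algebra_simps)
  qed
  have lapMs: "has_laplacian S (\<lambda>w. M w powr s) (\<lambda>w. of_real (s * M w powr (s - 1)) * gM w)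
      (\<lambda>w. s * M w powr (s - 1) * (4 * c w) + s * (s - 1) * M w powr (s - 2) * (cmod (gM w))\<^sup>2)"
    by (rule has_laplacian_powr[OF lapM pos(1)])
  have lapNq: "has_laplacian S (\<lambda>w. N w powr q) (\<lambda>w. of_real (q * N w powr (q - 1)) * gN w)
      (\<lambda>w. q * N w powr (q - 1) * (4 * e w + 4 * c w) + q * (q - 1) * N w powr (q - 2) * (cmod (gN w))\<^sup>2)" for q
    by (rule has_laplacian_powr[OF lapN pos(3)])
  note bM = powr_laplacian_bounds[OF pos(1) s zero_le_power2 gM]
  note bN = powr_laplacian_bounds[OF pos(3) s zero_le_power2 gN]
  define LM where "LM w = s * M w powr (s - 1) * (4 * c w) + s * (s - 1) * M w powr (s - 2) * (cmod (gM w))\<^sup>2" for w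
  define LN where "LN q w = q * N w powr (q - 1) * (4 * e w + 4 * c w) + q * (q - 1) * N w powr (q - 2) * (cmod (gN w))\<^sup>2" for q w
  have LN_upper: "LN s w \<le> 8 * s * max 1 s * c w * N w powr (s - 1)" if "w \<in> S" for w
  proof -
    have "LN s w \<le> s * max 1 s * N w powr (s - 1) * (4 * e w + 4 * c w)"
      unfolding LN_def by (rule bN(2))
    also have "\<dots> \<le> s * max 1 s * N w powr (s - 1) * (8 * c w)"
      using ec[OF that] s by (intro mult_left_mono) auto
    finally show ?thesis by (simp add: algebra_simps)
  qed
  have LM_lower: "4 * s * min 1 s * c w * M w powr (s - 1) \<le> LM w" for w
    using bM(1)[of w] unfolding LM_def by (simp add: algebra_simps)
  show ?thesis
  proof (cases "s \<le> 1")
    case True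
    show ?thesis
    proof (rule that)
      show "has_laplacian S (\<lambda>w. majorant s ((cmod (f w))\<^sup>2 + \<delta>) ((cmod (F w))\<^sup>2 + ((cmod (f w))\<^sup>2 + \<delta>)))
        (\<lambda>w. of_real (2 / s) * (of_real (s * M w powr (s - 1)) * gM w) +
             of_real (-1) * (of_real (s * N w powr (s - 1)) * gN w))
        (\<lambda>w. (2 / s) * LM w + (-1) * LN s w)"
        using has_laplacian_add[OF has_laplacian_cmult[OF lapMs, of "2 / s"] has_laplacian_cmult[OF lapNq[of s], of "-1"]] True
        unfolding majorant_def LM_def LN_def by (simp only: M_def[symmetric] N_def[symmetric] if_True)
      fix w assume w: "w \<in> S"
      \<comment> \<open>For s \<le> 1 the exponent is nonpositive, so M \<le> N reverses. The gain
        (2 / s) * 4 s^2 c M^(s-1) is then at least the loss 8 s c N^(s-1).\<close>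
      have "N w powr (s - 1) \<le> M w powr (s - 1)"
        using pos[of w] True by (intro powr_mono2') auto
      then have "8 * s * c w * N w powr (s - 1) \<le> 8 * s * c w * M w powr (s - 1)"
        using s ce by (intro mult_left_mono) auto
      moreover have "(2 / s) * (4 * s * s * c w * M w powr (s - 1)) \<le> (2 / s) * LM w"
        using LM_lower[of w] True s by (intro mult_left_mono) (auto simp: min_def)
      moreover have "(2 / s) * (4 * s * s * c w * M w powr (s - 1)) = 8 * s * c w * M w powr (s - 1)"
        using s by simp
      ultimately show "0 \<le> (2 / s) * LM w + (-1) * LN s w"
        using LN_upper[OF w] True unfolding max_absorb1[OF True] by linarith
    qed
  next
    case False
    define q where "q = s - 1"
    have q: "0 < q" using False by (simp add: q_def)
    define A where "A = 12 * q * (36 * q\<^sup>2) powr q"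
    have A: "0 \<le> A" using q by (simp add: A_def)
    define LW where "LW w = M w * LN q w + N w powr q * (4 * c w) +
        2 * (gM w \<bullet> (of_real (q * N w powr (q - 1)) * gN w))" for w
    have lapW: "has_laplacian S (\<lambda>w. M w * N w powr q)
        (\<lambda>w. of_real (M w) * (of_real (q * N w powr (q - 1)) * gN w) + of_real (N w powr q) * gM w) LW"
      using has_laplacian_mult[OF lapM lapNq[of q]] unfolding LW_def LN_def .
    show ?thesis
    proof (rule that)
      show "has_laplacian S (\<lambda>w. majorant s ((cmod (f w))\<^sup>2 + \<delta>) ((cmod (F w))\<^sup>2 + ((cmod (f w))\<^sup>2 + \<delta>)))
        (\<lambda>w. of_real (4 * s\<^sup>2) * (of_real (M w) * (of_real (q * N w powr (q - 1)) * gN w) + of_real (N w powr q) * gM w) +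
             of_real (s * A) * (of_real (s * M w powr (s - 1)) * gM w) +
             of_real (-1) * (of_real (s * N w powr (s - 1)) * gN w))
        (\<lambda>w. (4 * s\<^sup>2) * LW w + (s * A) * LM w + (-1) * LN s w)"
        using has_laplacian_add[OF has_laplacian_add[OF has_laplacian_cmult[OF lapW, of "4 * s\<^sup>2"]
              has_laplacian_cmult[OF lapMs, of "s * A"]] has_laplacian_cmult[OF lapNq[of s], of "-1"]] False
        unfolding majorant_def LM_def LN_def A_def
        by (simp only: M_def[symmetric] N_def[symmetric] q_def[symmetric] if_False)
      fix w assume w: "w \<in> S"
      \<comment> \<open>For s > 1 the balance is 4 s^2 (2 c N^q - A c M^q) + s A * 4 s c M^q - 8 s^2
        c N^q = 0. The part M times the Laplacian of N^q is nonnegative and is discarded.\<close>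
      have "0 \<le> q * min 1 q * N w powr (q - 1) * (4 * e w + 4 * c w)"
        using q ce by simp
      also have "\<dots> \<le> LN q w"
        unfolding LN_def by (rule powr_laplacian_bounds(1)[OF pos(3) q zero_le_power2 gN])
      finally have "0 \<le> M w * LN q w"
        using pos(1)[of w] by simp
      then have "2 * c w * N w powr q - c w * A * M w powr q \<le> LW w"
        using majorant_cross_term[OF pos(1,2) q ce(1) ec[OF w] gM gN]
        unfolding LW_def A_def by (simp add: algebra_simps)
      then have "(4 * s\<^sup>2) * (2 * c w * N w powr q - c w * A * M w powr q) \<le> (4 * s\<^sup>2) * LW w"
        by (intro mult_left_mono) auto
      moreover have "(s * A) * (4 * s * c w * M w powr q) \<le> (s * A) * LM w"
        using LM_lower[of w] False A s by (intro mult_left_mono) (auto simp: min_def q_def)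
      moreover have "LN s w \<le> 8 * s * s * c w * N w powr q"
        using LN_upper[OF w] False by (simp add: max_def q_def)
      ultimately show "0 \<le> (4 * s\<^sup>2) * LW w + (s * A) * LM w + (-1) * LN s w"
        by (simp add: algebra_simps power2_eq_square)
    qed
  qed
qed

section \<open>From subharmonic functions to Hardy means\<close>

lemma hardy_mean_eq_circle_integral:
  assumes "f holomorphic_on unit_disk" "0 \<le> r" "r < 1" "0 < p"
  shows "hardy_mean p f r = circle_integral (\<lambda>z. cmod (f z) powr p) r / (2 * pi)"
  using hardy_mean_eq_interval_integral[OF assms] by (simp add: circle_integral_def)

lemma circle_integral_integrable:
  fixes U :: "complex \<Rightarrow> real"
  assumes "continuous_on unit_disk U" "0 \<le> r" "r < 1"
  shows "(\<lambda>t. U (of_real r * cis t)) integrable_on {0..2*pi}"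
  by (rule integrable_continuous_interval continuous_on_circle[OF assms])+

lemma has_field_derivative_comp_exp:
  assumes "f holomorphic_on unit_disk" "Re w < 0"
  shows "((\<lambda>w. f (exp w)) has_field_derivative deriv f (exp w) * exp w) (at w)"
proof -
  have "exp w \<in> unit_disk" using assms(2) by simp
  then have "(f has_field_derivative deriv f (exp w)) (at (exp w))"
    using assms(1) by (intro holomorphic_derivI) auto
  then show ?thesis
    by (rule DERIV_chain2) (rule DERIV_exp)
qed

lemma cmod_square_powr_half: "((cmod z)\<^sup>2) powr (p / 2) = cmod z powr p"
  by (cases "z = 0") (simp_all add: powr_powr flip: powr_numeral)

text \<open>The integrand is jointly continuous in \<delta> and the angle on a compact rectangle,
  also at zeros of \<open>f\<close> since the exponent is positive; hence the limit passes under the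
  integral.\<close>

lemma tendsto_circle_integral_shift:
  assumes f: "f holomorphic_on unit_disk" and r: "0 \<le> r" "r < 1" and "0 < p"
  shows "((\<lambda>\<delta>. circle_integral (\<lambda>z. ((cmod (f z))\<^sup>2 + \<delta>) powr (p / 2)) r) \<longlongrightarrow>
           circle_integral (\<lambda>z. cmod (f z) powr p) r) (at_right 0)"
proof -
  have cf: "continuous_on ({0..1} \<times> cbox 0 (2*pi)) (\<lambda>x. f (of_real r * cis (snd x)))"
    by (rule continuous_on_compose2[OF holomorphic_on_imp_continuous_on[OF f]])
      (use r in \<open>auto intro!: continuous_intros simp: norm_mult\<close>)
  have "continuous_on ({0..1} \<times> cbox 0 (2*pi)) (\<lambda>x. ((cmod (f (of_real r * cis (snd x))))\<^sup>2 + fst x) powr (p / 2))"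
    by (rule continuous_on_powr') ((intro continuous_intros cf)+, use \<open>0 < p\<close> in auto)
  then have "continuous_on ({0..1} \<times> cbox 0 (2*pi)) (\<lambda>(\<delta>, t). ((cmod (f (of_real r * cis t)))\<^sup>2 + \<delta>) powr (p / 2))"
    by (simp add: case_prod_beta)
  from integral_continuous_on_param[OF this] have "continuous_on {0..1} (\<lambda>\<delta>. circle_integral (\<lambda>z. ((cmod (f z))\<^sup>2 + \<delta>) powr (p / 2)) r)"
    unfolding circle_integral_def cbox_interval .
  then have "((\<lambda>\<delta>. circle_integral (\<lambda>z. ((cmod (f z))\<^sup>2 + \<delta>) powr (p / 2)) r) \<longlongrightarrow>
      circle_integral (\<lambda>z. ((cmod (f z))\<^sup>2 + 0) powr (p / 2)) r) (at 0 within {0..1})"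
    unfolding continuous_on_def by (rule bspec) simp
  then show ?thesis
    by (simp add: at_within_Icc_at_right cmod_square_powr_half)
qed

text \<open>The power (|f|^2 + \<delta>)^(p/2) is subharmonic by the lower bound in
  \<open>powr_laplacian_bounds\<close>. Its circle integrals are therefore monotone, and the
  inequality survives \<delta> \<rightarrow> 0.\<close>

lemma hardy_mean_mono:
  assumes f: "f holomorphic_on unit_disk" and r: "0 \<le> r" "r \<le> r'" "r' < 1" and p: "0 < p"
  shows "hardy_mean p f r \<le> hardy_mean p f r'"
proof -
  let ?S = "{w::complex. Re w < 0}"
  have S: "open ?S" by (rule open_halfspace_Re_lt)
  have cf: "continuous_on unit_disk f"
    using f by (rule holomorphic_on_imp_continuous_on)
  have "circle_integral (\<lambda>z. ((cmod (f z))\<^sup>2 + \<delta>) powr (p / 2)) r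
      \<le> circle_integral (\<lambda>z. ((cmod (f z))\<^sup>2 + \<delta>) powr (p / 2)) r'" if \<delta>: "\<delta> > 0" for \<delta>
  proof -
    let ?f' = "\<lambda>w. deriv f (exp w) * exp w"
    define M where "M w = (cmod (f (exp w)))\<^sup>2 + \<delta>" for w
    define g where "g w = 2 * f (exp w) * cnj (?f' w)" for w
    have M: "0 < M w" for w using \<delta> by (simp add: M_def add_nonneg_pos)
    have "has_laplacian ?S M g (\<lambda>w. 4 * (cmod (?f' w))\<^sup>2)"
      unfolding M_def g_def
      by (rule has_laplacian_norm_square[OF S]) (auto intro: has_field_derivative_comp_exp f)
    note lap = has_laplacian_powr[OF this M, where s = "p / 2"]
    have g: "(cmod (g w))\<^sup>2 \<le> M w * (4 * (cmod (?f' w))\<^sup>2)" for w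
      using \<delta> by (simp add: g_def M_def norm_mult power_mult_distrib algebra_simps)
    have "0 \<le> p / 2 * min 1 (p / 2) * M w powr (p / 2 - 1) * (4 * (cmod (?f' w))\<^sup>2)" for w
      using p by simp
    note nonneg = order_trans[OF this powr_laplacian_bounds(1)[OF M _ zero_le_power2 g]]
    show ?thesis
    proof (rule circle_integral_mono_radius[OF _ lap[unfolded M_def] _ r])
      show "continuous_on unit_disk (\<lambda>z. ((cmod (f z))\<^sup>2 + \<delta>) powr (p / 2))"
        using \<delta> p by (intro continuous_on_powr' continuous_intros cf) auto
    qed (use nonneg[unfolded M_def] p in simp)
  qed
  then have "circle_integral (\<lambda>z. cmod (f z) powr p) r \<le> circle_integral (\<lambda>z. cmod (f z) powr p) r'"
    using r p
    by (intro tendsto_le[OF _ tendsto_circle_integral_shift[OF f, of r' p] tendsto_circle_integral_shift[OF f, of r p]])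
      (auto simp: eventually_at_right_less intro!: eventually_at_rightI[of 0 1])
  then show ?thesis
    using f r p by (simp add: hardy_mean_eq_circle_integral divide_right_mono)
qed

text \<open>The majorant is nonnegative at the origin and its circle integrals increase, so 0 is at
  most the circle integral of K M^s - |F|^p / 2. This yields the constant 2 K, which depends on
  \<open>p\<close> alone; finally \<delta> \<rightarrow> 0.\<close>

lemma subordinate_hardy_mean_bound:
  assumes p: "0 < p"
  obtains C where "0 \<le> C"
    "\<And>f F r. f holomorphic_on unit_disk \<Longrightarrow> F holomorphic_on unit_disk \<Longrightarrow> F 0 = 0 \<Longrightarrow>
       (\<And>z. z \<in> unit_disk \<Longrightarrow> cmod (deriv F z) \<le> cmod (deriv f z)) \<Longrightarrow> 0 \<le> r \<Longrightarrow> r < 1 \<Longrightarrow>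
       hardy_mean p F r \<le> C * hardy_mean p f r"
proof -
  define s where "s = p / 2"
  have s: "0 < s" using p by (simp add: s_def)
  obtain K where K: "0 \<le> K"
    "\<And>M N. 0 < M \<Longrightarrow> M \<le> N \<Longrightarrow> majorant s M N \<le> K * M powr s - N powr s / 2"
    using majorant_upper_bound[OF s] by blast
  show ?thesis
  proof (rule that[of "2 * K"])
    fix f F :: "complex \<Rightarrow> complex" and r :: real
    assume f: "f holomorphic_on unit_disk" and F: "F holomorphic_on unit_disk" and F0: "F 0 = 0"
      and sub: "\<And>z. z \<in> unit_disk \<Longrightarrow> cmod (deriv F z) \<le> cmod (deriv f z)"
      and r: "0 \<le> r" "r < 1"
    let ?S = "{w::complex. Re w < 0}"
    have S: "open ?S" by (rule open_halfspace_Re_lt)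
    have cf: "continuous_on unit_disk f" and cF: "continuous_on unit_disk F"
      using f F by (auto intro: holomorphic_on_imp_continuous_on)
    have cFp: "continuous_on unit_disk (\<lambda>z. cmod (F z) powr p)"
      using p by (intro continuous_on_powr' continuous_intros cF) auto
    have main: "circle_integral (\<lambda>z. cmod (F z) powr p) r
        \<le> 2 * K * circle_integral (\<lambda>z. ((cmod (f z))\<^sup>2 + \<delta>) powr (p / 2)) r" if \<delta>: "\<delta> > 0" for \<delta>
    proof -
      define M where "M z = (cmod (f z))\<^sup>2 + \<delta>" for z
      define N where "N z = (cmod (F z))\<^sup>2 + M z" for z
      have M: "0 < M z" "M z \<le> N z" "0 < N z" for z
        using \<delta> by (simp_all add: M_def N_def add_nonneg_pos)
      have cM: "continuous_on unit_disk M" "continuous_on unit_disk N"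
        unfolding M_def N_def by (intro continuous_intros cf cF)+
      have cU: "continuous_on unit_disk (\<lambda>z. majorant s (M z) (N z))"
        using cM M s by (intro continuous_on_majorant)
      have cMs: "continuous_on unit_disk (\<lambda>z. M z powr s)"
        using s by (intro continuous_on_powr' continuous_intros cM) (auto intro: less_imp_le M)
      obtain d L where lap: "has_laplacian ?S (\<lambda>w. majorant s (M (exp w)) (N (exp w))) d L"
        and L: "\<And>w. w \<in> ?S \<Longrightarrow> 0 \<le> L w"
        unfolding M_def N_def
      proof (rule majorant_subharmonic[OF S s \<delta>, of "\<lambda>w. f (exp w)" "\<lambda>w. deriv f (exp w) * exp w"
            "\<lambda>w. F (exp w)" "\<lambda>w. deriv F (exp w) * exp w"])
        show "cmod (deriv F (exp w) * exp w) \<le> cmod (deriv f (exp w) * exp w)" if "w \<in> ?S" for w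
          using sub[of "exp w"] that by (simp add: norm_mult)
      qed (auto intro: has_field_derivative_comp_exp f F)
      have "0 \<le> circle_integral (\<lambda>z. majorant s (M z) (N z)) 0"
        using majorant_diagonal_nonneg[OF s M(1)] F0 by (simp add: circle_integral_def N_def)
      also have "\<dots> \<le> circle_integral (\<lambda>z. majorant s (M z) (N z)) r"
        by (rule circle_integral_mono_radius[OF cU lap]) (use L r in auto)
      also have "\<dots> \<le> circle_integral (\<lambda>z. K * M z powr s - cmod (F z) powr p / 2) r"
        unfolding circle_integral_def
      proof (rule integral_le)
        show "(\<lambda>t. majorant s (M (of_real r * cis t)) (N (of_real r * cis t))) integrable_on {0..2*pi}"
          by (rule circle_integral_integrable[OF cU r])
        show "(\<lambda>t. K * M (of_real r * cis t) powr s - cmod (F (of_real r * cis t)) powr p / 2) integrable_on {0..2*pi}"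
          by (rule circle_integral_integrable[OF _ r]) (intro continuous_intros cMs cFp, simp)
        fix t
        let ?z = "of_real r * cis t"
        have "cmod (F ?z) powr p \<le> N ?z powr s"
          unfolding cmod_square_powr_half[symmetric] s_def
          by (rule powr_mono2) (use p M in \<open>auto simp: N_def less_imp_le\<close>)
        then show "majorant s (M ?z) (N ?z) \<le> K * M ?z powr s - cmod (F ?z) powr p / 2"
          using K(2)[OF M(1,2)[of ?z]] by linarith
      qed
      also have "\<dots> = K * circle_integral (\<lambda>z. M z powr s) r - circle_integral (\<lambda>z. cmod (F z) powr p) r / 2"
        unfolding circle_integral_def
        using circle_integral_integrable[OF cMs r] circle_integral_integrable[OF cFp r]
        by (subst integral_diff) (auto intro: integrable_on_mult_right integrable_on_divide)
      finally show ?thesis by (simp add: M_def s_def)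
    qed
    have "circle_integral (\<lambda>z. cmod (F z) powr p) r \<le> 2 * K * circle_integral (\<lambda>z. cmod (f z) powr p) r"
      by (rule tendsto_lowerbound[OF tendsto_mult_left[OF tendsto_circle_integral_shift[OF f r p]]])
        (use main in \<open>auto simp: intro!: eventually_at_rightI[of 0 1]\<close>)
    then show "hardy_mean p F r \<le> 2 * K * hardy_mean p f r"
      using f F r p by (simp add: hardy_mean_eq_circle_integral field_simps)
  qed (use K in simp)
qed

section \<open>Growth of Hardy space functions\<close>

definition disk_automorphism :: "complex \<Rightarrow> complex \<Rightarrow> complex" where
  "disk_automorphism a z = (z - a) / (1 - cnj a * z)"

text \<open>On the unit circle |1 - cnj a z| = |z - a|, so there this is the usual Poisson kernel at
  the point \<open>a\<close>.\<close>

definition poisson_kernel :: "complex \<Rightarrow> complex \<Rightarrow> real" where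
  "poisson_kernel a z = (1 - (cmod a)\<^sup>2) / (cmod (1 - cnj a * z))\<^sup>2"

lemma disk_automorphism_denominator_nonzero:
  assumes "cmod a < 1" "cmod z \<le> 1"
  shows "1 - cnj a * z \<noteq> 0"
proof
  assume "1 - cnj a * z = 0"
  then have "cmod a * cmod z = 1"
    by (metis complex_mod_cnj norm_mult norm_one right_minus_eq)
  moreover have "cmod a * cmod z \<le> cmod a * 1"
    using assms by (intro mult_left_mono) auto
  ultimately show False using assms by simp
qed

lemma cmod_disk_automorphism_le_1:
  assumes "cmod a < 1" "cmod z \<le> 1"
  shows "cmod (disk_automorphism a z) \<le> 1"
proof -
  have "(cmod (1 - cnj a * z))\<^sup>2 - (cmod (z - a))\<^sup>2 = (1 - (cmod a)\<^sup>2) * (1 - (cmod z)\<^sup>2)"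
    unfolding cmod_power2 by (simp add: power2_eq_square algebra_simps)
  moreover have "0 \<le> (1 - (cmod a)\<^sup>2) * (1 - (cmod z)\<^sup>2)"
    using assms by (intro mult_nonneg_nonneg) (simp_all add: power_le_one add_pos_nonneg)
  ultimately have "(cmod (z - a))\<^sup>2 \<le> (cmod (1 - cnj a * z))\<^sup>2" by linarith
  then have "cmod (z - a) \<le> cmod (1 - cnj a * z)"
    by (rule power2_le_imp_le) simp
  then show ?thesis
    using disk_automorphism_denominator_nonzero[OF assms]
    by (simp add: disk_automorphism_def norm_divide divide_le_eq)
qed

lemma integral_periodic_shift:
  fixes q :: "real \<Rightarrow> real"
  assumes cont: "continuous_on UNIV q" and per: "\<And>t. q (t + 2*pi) = q t" and c: "\<bar>c\<bar> \<le> 2*pi"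
  shows "integral {c..c + 2*pi} q = integral {0..2*pi} q"
proof -
  have int: "q integrable_on {a..b}" for a b
    by (rule integrable_continuous_interval[OF continuous_on_subset[OF cont]]) simp
  have shift: "integral {a + 2*pi..b + 2*pi} q = integral {a..b} q" for a b
  proof -
    have "q \<circ> (+) (2*pi) = q" using per by (auto simp: fun_eq_iff add.commute)
    then show ?thesis using integral_shift_Icc_real[of a b q "2*pi"] by simp
  qed
  have pos: "integral {c..c + 2*pi} q = integral {0..2*pi} q" if "0 \<le> c" "c \<le> 2*pi" for c
  proof -
    have "integral {c..2*pi} q + integral {2*pi..c + 2*pi} q = integral {c..c + 2*pi} q"
      using that int by (intro Henstock_Kurzweil_Integration.integral_combine) auto
    moreover have "integral {0..c} q + integral {c..2*pi} q = integral {0..2*pi} q"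
      using that int by (intro Henstock_Kurzweil_Integration.integral_combine) auto
    moreover have "integral {2*pi..c + 2*pi} q = integral {0..c} q"
      using shift[of 0 c] by simp
    ultimately show ?thesis by simp
  qed
  show ?thesis
  proof (cases "0 \<le> c")
    case False
    have "integral {c..c + 2*pi} q = integral {c + 2*pi..(c + 2*pi) + 2*pi} q"
      by (rule shift[symmetric])
    also have "\<dots> = integral {0..2*pi} q"
      using False c by (intro pos) auto
    finally show ?thesis .
  qed (use pos c in auto)
qed

text \<open>On the circle, \<open>disk_automorphism a (cis t) = cis (t + 2 arg (1 - a cis (-t)))\<close>, and the derivative of
  this angle is the Poisson kernel.\<close>
lemma circle_integral_disk_automorphism:
  fixes q :: "complex \<Rightarrow> real"
  assumes a: "cmod a < 1" and q: "continuous_on (sphere 0 1) q"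
  shows "((\<lambda>t. poisson_kernel a (cis t) * q (disk_automorphism a (cis t))) has_integral circle_integral q 1) {0..2*pi}"
proof -
  define w where "w t = 1 - a * cis (-t)" for t
  define \<theta> where "\<theta> t = t + 2 * Im (Ln (w t))" for t
  have w_pos: "0 < Re (w t)" for t
  proof -
    have "Re (a * cis (-t)) \<le> cmod (a * cis (-t))" by (rule complex_Re_le_cmod)
    then show ?thesis using a by (simp add: w_def norm_mult)
  qed
  have w_nz: "w t \<noteq> 0" for t using w_pos[of t] by auto
  have cnj_w: "cnj (w t) = 1 - cnj a * cis t" for t
    by (simp add: w_def cis_cnj)
  have cis_\<theta>: "cis (\<theta> t) = disk_automorphism a (cis t)" for t
  proof -
    have "cis (2 * Im (Ln (w t))) = exp (Ln (w t) - cnj (Ln (w t)))"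
      unfolding cis_conv_exp by (rule arg_cong[of _ _ exp]) (simp add: complex_eq_iff)
    also have "\<dots> = w t / cnj (w t)"
      using w_nz by (simp add: exp_diff flip: exp_cnj)
    finally have "cis (\<theta> t) = cis t * (w t / cnj (w t))"
      by (simp add: \<theta>_def flip: cis_mult)
    also have "\<dots> = (cis t - a) / cnj (w t)"
      by (simp add: w_def algebra_simps cis_mult)
    finally show ?thesis
      by (simp add: disk_automorphism_def cnj_w)
  qed
  have deriv: "(\<theta> has_real_derivative poisson_kernel a (cis t)) (at t within {0..2*pi})" for t
  proof -
    have "((\<lambda>z. 1 - a * exp (- \<i> * z)) has_field_derivative \<i> * a * exp (- \<i> * of_real t)) (at (of_real t))"
      by (rule derivative_eq_intros | simp)+
    then have "(w has_vector_derivative \<i> * a * cis (-t)) (at t)"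
      using has_vector_derivative_real_field by (fastforce simp: w_def[abs_def] cis_conv_exp)
    moreover have "(Ln has_field_derivative inverse (w t)) (at (w t))"
      using w_pos by (intro has_field_derivative_Ln) (metis complex_nonpos_Reals_iff not_le)
    ultimately have "((Ln \<circ> w) has_vector_derivative \<i> * a * cis (-t) * inverse (w t)) (at t)"
      by (rule field_vector_diff_chain_at)
    from bounded_linear.has_vector_derivative[OF bounded_linear_Im this]
    have "((\<lambda>t. Im (Ln (w t))) has_real_derivative Im (\<i> * a * cis (-t) * inverse (w t))) (at t)"
      by (simp add: has_real_derivative_iff_has_vector_derivative)
    then have "(\<theta> has_real_derivative 1 + 2 * Im (\<i> * a * cis (-t) * inverse (w t))) (at t)"
      unfolding \<theta>_def by (intro DERIV_add DERIV_ident DERIV_cmult)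
    \<comment> \<open>With b = a cis (-t) this is the identity 1 + 2 Re (b / (1 - b)) = (1 - |b|^2)
      / |1 - b|^2.\<close>
    moreover have "1 + 2 * Im (\<i> * a * cis (-t) * inverse (w t)) = poisson_kernel a (cis t)"
    proof -
      define b where "b = a * cis (-t)"
      have wb: "w t = 1 - b" and cb: "cmod b = cmod a"
        by (simp_all add: w_def b_def norm_mult)
      have nz: "(cmod (1 - b))\<^sup>2 \<noteq> 0" using w_nz[of t] wb by simp
      have "Im (\<i> * b * inverse (1 - b)) = Re (b * cnj (1 - b)) / (cmod (1 - b))\<^sup>2"
        by (simp add: divide_inverse[symmetric] complex_div_cnj[of _ "1 - b"] mult.assoc)
      then have "1 + 2 * Im (\<i> * b * inverse (1 - b)) = ((cmod (1 - b))\<^sup>2 + 2 * Re (b * cnj (1 - b))) / (cmod (1 - b))\<^sup>2"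
        using nz by (simp add: field_simps)
      also have "(cmod (1 - b))\<^sup>2 + 2 * Re (b * cnj (1 - b)) = 1 - (cmod b)\<^sup>2"
        unfolding cmod_power2 by (simp add: power2_eq_square algebra_simps)
      also have "cmod (1 - b) = cmod (1 - cnj a * cis t)"
        using cnj_w[of t] wb by (metis complex_mod_cnj)
      finally have "1 + 2 * Im (\<i> * b * inverse (1 - b)) = poisson_kernel a (cis t)"
        unfolding poisson_kernel_def cb .
      then show ?thesis
        unfolding wb b_def by (simp only: mult.assoc)
    qed
    ultimately show ?thesis
      by (simp add: has_field_derivative_at_within)
  qed
  have bound: "\<bar>2 * Im (Ln (w t))\<bar> \<le> 2*pi" for t
    using Im_Ln_le_pi[OF w_nz[of t]] mpi_less_Im_Ln[OF w_nz[of t]] by linarith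
  \<comment> \<open>The correction to the angle has period 2 pi, so \<theta> sweeps exactly one full
    period and the substituted integral is again over the whole circle.\<close>
  have \<theta>_end: "\<theta> (2*pi) = \<theta> 0 + 2*pi"
    by (simp add: \<theta>_def w_def flip: cis_cnj)
  have cq: "continuous_on T (\<lambda>t. q (cis t))" for T
    by (rule continuous_on_compose2[OF q]) (auto intro!: continuous_intros)
  have "((\<lambda>t. poisson_kernel a (cis t) *\<^sub>R q (cis (\<theta> t))) has_integral integral {\<theta> 0..\<theta> (2*pi)} (\<lambda>t. q (cis t))) {0..2*pi}"
  proof (rule has_integral_substitution[where c = "-2*pi" and d = "4*pi"])
    show "\<theta> ` {0..2*pi} \<subseteq> {-2*pi..4*pi}"
    proof (rule image_subsetI)
      fix t assume "t \<in> {0..2*pi}"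
      then show "\<theta> t \<in> {-2*pi..4*pi}" using bound[of t] by (auto simp: \<theta>_def abs_le_iff)
    qed
  qed (use deriv cq \<theta>_end in auto)
  moreover have "integral {\<theta> 0..\<theta> (2*pi)} (\<lambda>t. q (cis t)) = circle_integral q 1"
    unfolding \<theta>_end circle_integral_def using bound[of 0]
    by (subst integral_periodic_shift[OF cq]) (auto simp: \<theta>_def simp flip: cis_mult)
  ultimately show ?thesis by (simp add: cis_\<theta>)
qed

text \<open>Composing with an automorphism moves \<open>z\<close> to the origin, where |F z|^p is
  bounded by a circle mean. Changing variables back costs at most the reciprocal of the minimum of
  the Poisson kernel, (1 + |a|) / (1 - |a|).\<close>

lemma hardy_pointwise_bound:
  assumes F: "F holomorphic_on unit_disk" and p: "0 < p"
    and L: "\<And>r. 0 \<le> r \<Longrightarrow> r < 1 \<Longrightarrow> hardy_mean p F r \<le> L" and z: "cmod z < 1"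
  shows "cmod (F z) powr p \<le> 4 * L / (1 - cmod z)"
proof -
  \<comment> \<open>The radius lies halfway between |z| and 1, so F is defined beyond the circle of
    radius \<open>R\<close>; \<open>a\<close> is chosen so that
    \<open>R * disk_automorphism a 0 = z\<close>.\<close>
  define R where "R = (1 + cmod z) / 2"
  define a where "a = - z / of_real R"
  have R: "0 < R" "cmod z < R" "R < 1" using z by (auto simp: R_def add_pos_nonneg)
  have a_norm: "cmod a = cmod z / R" using R by (simp add: a_def norm_divide)
  have a: "cmod a < 1" using R by (simp add: a_norm)
  define H where "H \<zeta> = F (of_real R * disk_automorphism a \<zeta>)" for \<zeta>
  have in_disk: "of_real R * disk_automorphism a \<zeta> \<in> unit_disk" if "cmod \<zeta> \<le> 1" for \<zeta>
  proof -
    have "R * cmod (disk_automorphism a \<zeta>) \<le> R * 1"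
      using R cmod_disk_automorphism_le_1[OF a that] by (intro mult_left_mono) auto
    then have "R * cmod (disk_automorphism a \<zeta>) < 1" using R by linarith
    then show ?thesis using R by (simp add: norm_mult)
  qed
  have nz: "1 - cnj a * \<zeta> \<noteq> 0" if "cmod \<zeta> \<le> 1" for \<zeta>
    using disk_automorphism_denominator_nonzero[OF a that] .
  have "(\<lambda>\<zeta>. of_real R * disk_automorphism a \<zeta>) holomorphic_on unit_disk"
    unfolding disk_automorphism_def using nz by (intro holomorphic_intros) auto
  then have "(F \<circ> (\<lambda>\<zeta>. of_real R * disk_automorphism a \<zeta>)) holomorphic_on unit_disk"
    by (rule holomorphic_on_compose_gen[OF _ F]) (use in_disk in auto)
  then have hH: "H holomorphic_on unit_disk"
    by (simp add: H_def[abs_def] comp_def)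
  have cF: "continuous_on unit_disk F" using F by (rule holomorphic_on_imp_continuous_on)
  have cD: "continuous_on (cball 0 1) (\<lambda>\<zeta>. of_real R * disk_automorphism a \<zeta>)"
    unfolding disk_automorphism_def using nz by (intro continuous_intros) auto
  have cH: "continuous_on (cball 0 1) H"
    unfolding H_def by (rule continuous_on_compose2[OF cF cD]) (use in_disk in auto)
  have cHp: "continuous_on (cball 0 1) (\<lambda>z. cmod (H z) powr p)"
    using p by (intro continuous_on_powr' continuous_intros cH) auto
  have Hz: "H 0 = F z" using R by (simp add: H_def disk_automorphism_def a_def)
  \<comment> \<open>Monotonicity of means is available only for r < 1, while the change of variables
    lives on the unit circle; continuity of \<open>H\<close> on the closed disk bridges the
    gap.\<close>
  have "continuous_on ({0..1} \<times> cbox 0 (2*pi)) (\<lambda>(r, t). cmod (H (of_real r * cis t)) powr p)"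
    unfolding case_prod_beta
    by (rule continuous_on_compose2[OF cHp]) (auto intro!: continuous_intros simp: norm_mult)
  from integral_continuous_on_param[OF this]
  have "continuous_on {0..1} (circle_integral (\<lambda>z. cmod (H z) powr p))"
    unfolding circle_integral_def[abs_def] cbox_interval .
  then have "(circle_integral (\<lambda>z. cmod (H z) powr p) \<longlongrightarrow> circle_integral (\<lambda>z. cmod (H z) powr p) 1) (at 1 within {0..1})"
    unfolding continuous_on_def by (rule bspec) simp
  then have lim: "(circle_integral (\<lambda>z. cmod (H z) powr p) \<longlongrightarrow> circle_integral (\<lambda>z. cmod (H z) powr p) 1) (at_left 1)"
    by (simp add: at_within_Icc_at_left)
  have "2 * pi * cmod (F z) powr p \<le> circle_integral (\<lambda>z. cmod (H z) powr p) r" if "0 \<le> r" "r < 1" for r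
  proof -
    have "hardy_mean p H 0 \<le> hardy_mean p H r"
      using hardy_mean_mono[OF hH] that p by simp
    moreover have "hardy_mean p H 0 = cmod (F z) powr p"
      using hardy_mean_eq_circle_integral[OF hH, of 0 p] p by (simp add: circle_integral_def Hz)
    ultimately show ?thesis
      using hardy_mean_eq_circle_integral[OF hH that p] by (simp add: field_simps)
  qed
  then have "2 * pi * cmod (F z) powr p \<le> circle_integral (\<lambda>z. cmod (H z) powr p) 1"
    by (intro tendsto_lowerbound[OF lim] eventually_at_leftI[of 0 1]) auto
  also have "\<dots> \<le> (1 + cmod a) / (1 - cmod a) * circle_integral (\<lambda>\<zeta>. cmod (F (of_real R * \<zeta>)) powr p) 1"
  proof -
    have cq: "continuous_on (sphere 0 1) (\<lambda>\<zeta>. cmod (F (of_real R * \<zeta>)) powr p)"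
      using p R
      by (intro continuous_on_powr' continuous_on_norm continuous_on_compose2[OF cF])
        (auto intro!: continuous_intros simp: norm_mult)
    note I = has_integral_mult_right[OF circle_integral_disk_automorphism[OF a cq],
        of "(1 + cmod a) / (1 - cmod a)", folded H_def]
    have cH1: "continuous_on {0..2*pi} (\<lambda>t. cmod (H (cis t)) powr p)"
      by (rule continuous_on_compose2[OF cHp]) (auto intro!: continuous_intros)
    have J: "((\<lambda>t. cmod (H (cis t)) powr p) has_integral circle_integral (\<lambda>z. cmod (H z) powr p) 1) {0..2*pi}"
      unfolding circle_integral_def of_real_1 mult_1
      using cH1 by (intro integrable_integral integrable_continuous_interval)
    show ?thesis
    proof (rule has_integral_le[OF J I])
      fix t
      define c where "c = cmod a"
      define den where "den = cmod (1 - cnj a * cis t)"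
      have c: "0 \<le> c" "c < 1" using a by (simp_all add: c_def)
      have den: "0 < den" "den \<le> 1 + c"
        using nz[of "cis t"] norm_triangle_ineq4[of 1 "cnj a * cis t"]
        by (simp_all add: den_def c_def norm_mult)
      \<comment> \<open>The bound den \<le> 1 + c shows that the Poisson kernel is at least (1 - c)
        / (1 + c).\<close>
      have "(1 - c) * den\<^sup>2 \<le> (1 - c) * (1 + c)\<^sup>2"
        using c den by (intro mult_left_mono power_mono) auto
      also have "\<dots> = (1 + c) * (1 - c\<^sup>2)"
        by (simp add: power2_eq_square algebra_simps)
      finally have "1 \<le> ((1 + c) * (1 - c\<^sup>2)) / ((1 - c) * den\<^sup>2)"
        using c den by (subst le_divide_eq_1_pos) auto
      then have "1 \<le> (1 + cmod a) / (1 - cmod a) * poisson_kernel a (cis t)"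
        unfolding poisson_kernel_def times_divide_times_eq by (simp only: c_def den_def)
      then have "1 * cmod (H (cis t)) powr p \<le> ((1 + cmod a) / (1 - cmod a) * poisson_kernel a (cis t)) * cmod (H (cis t)) powr p"
        by (intro mult_right_mono) auto
      then show "cmod (H (cis t)) powr p \<le> (1 + cmod a) / (1 - cmod a) * (poisson_kernel a (cis t) * cmod (H (cis t)) powr p)"
        by (simp only: mult.assoc mult_1)
    qed
  qed
  also have "circle_integral (\<lambda>\<zeta>. cmod (F (of_real R * \<zeta>)) powr p) 1 = 2 * pi * hardy_mean p F R"
    using R p by (simp add: hardy_mean_eq_circle_integral[OF F] circle_integral_def)
  finally have "2 * pi * cmod (F z) powr p \<le> 2 * pi * ((1 + cmod a) / (1 - cmod a) * hardy_mean p F R)"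
    by (simp only: mult_ac)
  then have "cmod (F z) powr p \<le> (1 + cmod a) / (1 - cmod a) * hardy_mean p F R"
    by (rule mult_left_le_imp_le) simp
  also have "\<dots> \<le> (1 + cmod a) / (1 - cmod a) * L"
    using a L[of R] R by (intro mult_left_mono) auto
  also have "\<dots> \<le> (4 / (1 - cmod z)) * L"
  proof (rule mult_right_mono)
    have pos: "0 < 1 + cmod z" using norm_ge_zero[of z] by linarith
    have "cmod a = 2 * cmod z / (1 + cmod z)" by (simp add: a_norm R_def)
    then have "1 + cmod a = (1 + 3 * cmod z) / (1 + cmod z)" "1 - cmod a = (1 - cmod z) / (1 + cmod z)"
      using pos by (simp_all add: field_simps)
    then have "(1 + cmod a) / (1 - cmod a) = (1 + 3 * cmod z) / (1 - cmod z)"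
      using pos by simp
    also have "\<dots> \<le> 4 / (1 - cmod z)" using z by (intro divide_right_mono) auto
    finally show "(1 + cmod a) / (1 - cmod a) \<le> 4 / (1 - cmod z)" .
    have "0 \<le> hardy_mean p F 0"
      using p hardy_mean_eq_circle_integral[OF F, of 0 p] by (simp add: circle_integral_def)
    then show "0 \<le> L" using L[of 0] by simp
  qed
  finally show ?thesis by simp
qed

section \<open>Hardy norms through uniform bounds on the means\<close>

lemma hardy_mean_nonneg: "0 \<le> hardy_mean p f r"
  unfolding hardy_mean_def by (rule Bochner_Integration.integral_nonneg) simp

lemma hardy_spaceE:
  assumes "f \<in> hardy_space p" "0 < p"
  obtains L where "f holomorphic_on unit_disk" "0 \<le> L" "hardy_norm p f = L powr (1 / p)"
    "\<And>r. 0 \<le> r \<Longrightarrow> r < 1 \<Longrightarrow> hardy_mean p f r \<le> L"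
proof -
  obtain L where f: "f holomorphic_on unit_disk" and L: "(hardy_mean p f \<longlongrightarrow> L) (at_left 1)"
    using assms(1) by (auto simp: hardy_space_def)
  show ?thesis
  proof (rule that[OF f])
    show "0 \<le> L"
      by (rule tendsto_lowerbound[OF L]) (simp_all add: hardy_mean_nonneg)
    show "hardy_norm p f = L powr (1 / p)"
      by (simp add: hardy_norm_def tendsto_Lim[OF _ L])
    show "hardy_mean p f r \<le> L" if "0 \<le> r" "r < 1" for r
      by (rule tendsto_lowerbound[OF L])
        (use that assms(2) hardy_mean_mono[OF f] in \<open>auto intro!: eventually_at_leftI[of r 1]\<close>)
  qed
qed

text \<open>The means increase with the radius, so a uniform bound makes them converge to their
  supremum.\<close>

lemma hardy_space_boundedI:
  assumes f: "f holomorphic_on unit_disk" and p: "0 < p"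
    and B: "\<And>r. 0 \<le> r \<Longrightarrow> r < 1 \<Longrightarrow> hardy_mean p f r \<le> B"
  shows "f \<in> hardy_space p" and "hardy_norm p f \<le> B powr (1 / p)"
proof -
  define L where "L = (SUP r\<in>{0..<1}. hardy_mean p f r)"
  have bdd: "bdd_above (hardy_mean p f ` {0..<1})"
    using B by (intro bdd_aboveI[of _ B]) auto
  have upper: "hardy_mean p f r \<le> L" if "0 \<le> r" "r < 1" for r
    unfolding L_def by (rule cSUP_upper[OF _ bdd]) (use that in simp)
  have L: "(hardy_mean p f \<longlongrightarrow> L) (at_left 1)"
  proof (rule increasing_tendsto)
    show "eventually (\<lambda>r. hardy_mean p f r \<le> L) (at_left 1)"
      using upper by (auto intro!: eventually_at_leftI[of 0 1])
    fix x assume "x < L"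
    then obtain r where r: "0 \<le> r" "r < 1" "x < hardy_mean p f r"
      unfolding L_def using bdd by (auto simp: less_cSUP_iff)
    show "eventually (\<lambda>r. x < hardy_mean p f r) (at_left 1)"
      using r hardy_mean_mono[OF f _ _ _ p, of r]
      by (auto intro!: eventually_at_leftI[of r 1] intro: less_le_trans)
  qed
  then show "f \<in> hardy_space p"
    using f by (auto simp: hardy_space_def)
  have "L \<le> B"
    unfolding L_def by (rule cSUP_least) (use B in auto)
  moreover have "0 \<le> L"
    using order_trans[OF hardy_mean_nonneg upper[of 0]] by simp
  ultimately show "hardy_norm p f \<le> B powr (1 / p)"
    unfolding hardy_norm_def tendsto_Lim[OF trivial_limit_at_left_real L]
    using p by (intro powr_mono2) auto
qed

text \<open>Cauchy's estimate on the disk of radius \<rho> = (1 - |z|) / 2 about \<open>z\<close>: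
  its points still have distance at least \<rho> from the unit circle, where the pointwise bound
  applies uniformly.\<close>

lemma hardy_space_deriv_bound:
  assumes f: "f \<in> hardy_space p" and p: "0 < p" and z: "cmod z < 1"
  shows "cmod (deriv f z) \<le> 2 * (8 / (1 - cmod z)) powr (1 / p) * hardy_norm p f / (1 - cmod z)"
proof -
  obtain L where hf: "f holomorphic_on unit_disk" and L: "0 \<le> L" "hardy_norm p f = L powr (1 / p)"
    "\<And>r. 0 \<le> r \<Longrightarrow> r < 1 \<Longrightarrow> hardy_mean p f r \<le> L"
    using hardy_spaceE[OF f p] by blast
  define \<rho> where "\<rho> = (1 - cmod z) / 2"
  have \<rho>: "0 < \<rho>" using z by (simp add: \<rho>_def)
  have sub: "cball z \<rho> \<subseteq> unit_disk"
  proof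
    fix x assume "x \<in> cball z \<rho>"
    then have "cmod x \<le> cmod z + \<rho>"
      using norm_triangle_ineq2[of x z] by (simp add: dist_norm norm_minus_commute)
    then show "x \<in> unit_disk" using z by (simp add: \<rho>_def field_simps)
  qed
  have "cmod ((deriv ^^ 1) f z) \<le> fact 1 * (4 * L / \<rho>) powr (1 / p) / \<rho> ^ 1"
  proof (rule Cauchy_inequality[OF _ _ \<rho>])
    show "f holomorphic_on ball z \<rho>"
      by (rule holomorphic_on_subset[OF hf]) (use sub in auto)
    show "continuous_on (cball z \<rho>) f"
      by (rule holomorphic_on_imp_continuous_on[OF holomorphic_on_subset[OF hf sub]])
    fix x assume "cmod (z - x) = \<rho>"
    then have x: "cmod x \<le> cmod z + \<rho>"
      using norm_triangle_ineq2[of x z] by (simp add: norm_minus_commute)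
    then have x1: "cmod x < 1" "\<rho> \<le> 1 - cmod x" using z by (simp_all add: \<rho>_def field_simps)
    have "cmod (f x) powr p \<le> 4 * L / (1 - cmod x)"
      by (rule hardy_pointwise_bound[OF hf p L(3) x1(1)])
    also have "\<dots> \<le> 4 * L / \<rho>"
      using L(1) x1 \<rho> by (intro divide_left_mono) auto
    finally have "(cmod (f x) powr p) powr (1 / p) \<le> (4 * L / \<rho>) powr (1 / p)"
      using p by (intro powr_mono2) auto
    then show "cmod (f x) \<le> (4 * L / \<rho>) powr (1 / p)"
      using p by (simp add: powr_powr)
  qed
  also have "\<dots> = 2 * (8 / (1 - cmod z) * L) powr (1 / p) / (1 - cmod z)"
    by (simp add: \<rho>_def field_simps)
  also have "(8 / (1 - cmod z) * L) powr (1 / p) = (8 / (1 - cmod z)) powr (1 / p) * L powr (1 / p)"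
    by (rule powr_mult)
  finally show ?thesis by (simp add: L(2) mult.assoc)
qed

section \<open>The Volterra type operator\<close>

text \<open>The principal branch of (1 - cnj a z)^(-2/p). This exponent makes |f|^p equal to |1 -
  cnj a z|^(-2), a multiple of the Poisson kernel.\<close>

definition test_function :: "real \<Rightarrow> complex \<Rightarrow> complex \<Rightarrow> complex" where
  "test_function p a z = exp (- (2 / of_real p) * Ln (1 - cnj a * z))"

lemma test_function_denominator_Re_pos:
  assumes "cmod a < 1" "cmod z < 1"
  shows "0 < Re (1 - cnj a * z)"
proof -
  have "Re (cnj a * z) \<le> cmod a * cmod z"
    using complex_Re_le_cmod[of "cnj a * z"] by (simp add: norm_mult)
  also have "\<dots> \<le> cmod a * 1" using assms by (intro mult_left_mono) auto
  finally show ?thesis using assms by simp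
qed

lemma has_field_derivative_test_function:
  assumes "cmod a < 1" "cmod z < 1" "0 < p"
  shows "(test_function p a has_field_derivative test_function p a z * (2 / of_real p * cnj a / (1 - cnj a * z))) (at z)"
proof -
  have "1 - cnj a * z \<notin> \<real>\<^sub>\<le>\<^sub>0" "1 - cnj a * z \<noteq> 0"
    using test_function_denominator_Re_pos[OF assms(1,2)]
    by (metis complex_nonpos_Reals_iff not_le, metis less_irrefl zero_complex.sel(1))
  then show ?thesis
    unfolding test_function_def[abs_def]
    by (auto intro!: derivative_eq_intros simp: divide_inverse)
qed

lemma holomorphic_test_function:
  assumes "cmod a < 1" "0 < p"
  shows "test_function p a holomorphic_on unit_disk"
proof (rule holomorphic_onI)
  fix z :: complex assume "z \<in> unit_disk"
  then have "(test_function p a has_field_derivative test_function p a z * (2 / of_real p * cnj a / (1 - cnj a * z))) (at z)"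
    using assms by (intro has_field_derivative_test_function) auto
  then show "test_function p a field_differentiable at z within unit_disk"
    using field_differentiable_at_within field_differentiable_def by blast
qed

lemma cmod_test_function:
  assumes "cmod a < 1" "cmod z < 1" "0 < p"
  shows "cmod (test_function p a z) = cmod (1 - cnj a * z) powr (- 2 / p)"
proof -
  have nz: "1 - cnj a * z \<noteq> 0"
    using test_function_denominator_Re_pos[OF assms(1,2)] by (metis less_irrefl zero_complex.sel(1))
  have "Re (- (2 / of_real p) * Ln (1 - cnj a * z)) = - 2 / p * ln (cmod (1 - cnj a * z))"
  proof -
    have "- (2 / complex_of_real p) = complex_of_real (- 2 / p)" by simp
    then show ?thesis using nz by (simp only: Re_complex_of_real times_complex.sel Im_complex_of_real Re_Ln) simp
  qed
  then show ?thesis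
    using nz by (simp add: test_function_def norm_exp_eq_Re powr_def)
qed

text \<open>On the circle of radius \<open>r\<close> the p-th power is the Poisson kernel at b = r a
  divided by 1 - |b|^2. The kernel has mean 1, by the change of variables applied to the constant
  1.\<close>

lemma hardy_mean_test_function:
  assumes a: "cmod a < 1" and p: "0 < p" and r: "0 \<le> r" "r < 1"
  shows "hardy_mean p (test_function p a) r = 1 / (1 - (r * cmod a)\<^sup>2)"
proof -
  define b where "b = of_real r * a"
  have b_norm: "cmod b = r * cmod a" using r by (simp add: b_def norm_mult)
  have "r * cmod a \<le> 1 * cmod a" using r by (intro mult_right_mono) auto
  then have b: "cmod b < 1" using a by (simp add: b_norm)
  have hol: "test_function p a holomorphic_on unit_disk"
    by (rule holomorphic_test_function[OF a p])
  have pos: "0 < 1 - (cmod b)\<^sup>2" using b by (simp add: power_less_one_iff abs_square_less_1)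
  have "((\<lambda>t. poisson_kernel b (cis t) * 1) has_integral circle_integral (\<lambda>_. 1) 1) {0..2*pi}"
    by (rule circle_integral_disk_automorphism[OF b]) simp
  then have I: "integral {0..2*pi} (\<lambda>t. poisson_kernel b (cis t)) = 2 * pi"
    by (simp add: circle_integral_def integral_unique)
  have "cmod (test_function p a (of_real r * cis t)) powr p = 1 / (1 - (cmod b)\<^sup>2) * poisson_kernel b (cis t)" for t
  proof -
    have eq: "1 - cnj a * (of_real r * cis t) = 1 - cnj b * cis t" by (simp add: b_def)
    have "1 - cnj b * cis t \<noteq> 0"
      using disk_automorphism_denominator_nonzero[OF b] by simp
    then have "(cmod (1 - cnj b * cis t) powr (- 2 / p)) powr p = 1 / (cmod (1 - cnj b * cis t))\<^sup>2"
      unfolding powr_powr using p by (simp add: powr_neg_numeral)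
    then have "cmod (test_function p a (of_real r * cis t)) powr p = 1 / (cmod (1 - cnj b * cis t))\<^sup>2"
      using r p by (subst cmod_test_function[OF a]) (simp_all add: norm_mult eq)
    then show ?thesis using pos by (simp add: poisson_kernel_def)
  qed
  then have "circle_integral (\<lambda>z. cmod (test_function p a z) powr p) r = 1 / (1 - (cmod b)\<^sup>2) * (2 * pi)"
    by (simp add: circle_integral_def I)
  then show ?thesis
    using hardy_mean_eq_circle_integral[OF hol r p] by (simp add: b_norm)
qed

lemma test_function_hardy_space:
  assumes a: "cmod a < 1" and p: "0 < p"
  shows "test_function p a \<in> hardy_space p"
    and "hardy_norm p (test_function p a) \<le> (1 / (1 - (cmod a)\<^sup>2)) powr (1 / p)"
proof -
  have hol: "test_function p a holomorphic_on unit_disk"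
    by (rule holomorphic_test_function[OF a p])
  have "hardy_mean p (test_function p a) r \<le> 1 / (1 - (cmod a)\<^sup>2)" if "0 \<le> r" "r < 1" for r
  proof -
    have "r * cmod a \<le> 1 * cmod a" using that by (intro mult_right_mono) auto
    then have "(r * cmod a)\<^sup>2 \<le> (cmod a)\<^sup>2" using that by (intro power_mono) auto
    moreover have "(cmod a)\<^sup>2 < 1" using a by (simp add: abs_square_less_1)
    ultimately show ?thesis
      unfolding hardy_mean_test_function[OF a p that] by (intro divide_left_mono) auto
  qed
  then show "test_function p a \<in> hardy_space p"
    "hardy_norm p (test_function p a) \<le> (1 / (1 - (cmod a)\<^sup>2)) powr (1 / p)"
    using hardy_space_boundedI[OF hol p] by blast+
qed

section \<open>Basic properties of the operator and the two implications\<close>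

lemma volterra_S_properties:
  assumes f: "f holomorphic_on unit_disk" and g: "g holomorphic_on unit_disk"
  shows "volterra_S g f holomorphic_on unit_disk" "volterra_S g f 0 = 0"
    "\<And>z. z \<in> unit_disk \<Longrightarrow> deriv (volterra_S g f) z = deriv f z * g z"
proof -
  have "(\<lambda>w. deriv f w * g w) holomorphic_on unit_disk"
    using f g by (intro holomorphic_intros) auto
  then obtain P where P: "\<And>z. z \<in> unit_disk \<Longrightarrow> (P has_field_derivative deriv f z * g z) (at z within unit_disk)"
    using holomorphic_convex_primitive'[OF convex_ball open_ball] by blast
  have eq: "volterra_S g f z = P z - P 0" if z: "z \<in> unit_disk" for z
  proof -
    have "((\<lambda>w. deriv f w * g w) has_contour_integral P (pathfinish (linepath 0 z)) - P (pathstart (linepath 0 z))) (linepath 0 z)"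
    proof (rule contour_integral_primitive[OF P])
      show "path_image (linepath 0 z) \<subseteq> unit_disk"
        using z by (simp add: closed_segment_subset)
    qed auto
    then show ?thesis
      unfolding volterra_S_def by (simp add: contour_integral_unique)
  qed
  have D: "(volterra_S g f has_field_derivative deriv f z * g z) (at z)" if z: "z \<in> unit_disk" for z
  proof -
    have "(P has_field_derivative deriv f z * g z) (at z)"
      using P[OF z] unfolding at_within_open[OF z open_ball] .
    then have "((\<lambda>z. P z - P 0) has_field_derivative deriv f z * g z) (at z)"
      by (auto intro!: derivative_eq_intros)
    then show ?thesis
      by (rule has_field_derivative_transform_within_open[where S = unit_disk]) (use z eq in auto)
  qed
  show "volterra_S g f holomorphic_on unit_disk"
    using D field_differentiable_at_within unfolding holomorphic_on_def field_differentiable_def by blast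
  show "volterra_S g f 0 = 0" using eq[of 0] by simp
  show "deriv (volterra_S g f) z = deriv f z * g z" if "z \<in> unit_disk" for z
    using D[OF that] by (rule DERIV_imp_deriv)
qed

text \<open>If |g| \<le> B, then S_g f is subordinate to B f, since its derivative is f' g. Scaling
  by \<open>B\<close> multiplies the means by B^p.\<close>

lemma volterra_S_bounded_if_bounded_symbol:
  assumes g: "g \<in> hardy_space_infinity" and p: "0 < p"
  shows "bounded_on_hardy_space p (volterra_S g)"
proof -
  have hg: "g holomorphic_on unit_disk" using g by (simp add: hardy_space_infinity_def)
  obtain B where B: "0 < B" "\<And>z. z \<in> unit_disk \<Longrightarrow> cmod (g z) \<le> B"
    using g unfolding hardy_space_infinity_def bounded_pos by auto
  obtain C where C: "0 \<le> C"
    "\<And>f F r. f holomorphic_on unit_disk \<Longrightarrow> F holomorphic_on unit_disk \<Longrightarrow> F 0 = 0 \<Longrightarrow>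
       (\<And>z. z \<in> unit_disk \<Longrightarrow> cmod (deriv F z) \<le> cmod (deriv f z)) \<Longrightarrow> 0 \<le> r \<Longrightarrow> r < 1 \<Longrightarrow>
       hardy_mean p F r \<le> C * hardy_mean p f r"
    using subordinate_hardy_mean_bound[OF p] by blast
  have main: "volterra_S g f \<in> hardy_space p \<and>
      hardy_norm p (volterra_S g f) \<le> (C * B powr p) powr (1 / p) * hardy_norm p f" if f0: "f \<in> hardy_space p" for f
  proof -
    obtain L where f: "f holomorphic_on unit_disk" and L: "0 \<le> L" "hardy_norm p f = L powr (1 / p)"
      "\<And>r. 0 \<le> r \<Longrightarrow> r < 1 \<Longrightarrow> hardy_mean p f r \<le> L"
      using hardy_spaceE[OF f0 p] by blast
    note S = volterra_S_properties[OF f hg]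
    have hol: "(\<lambda>z. of_real B * f z) holomorphic_on unit_disk"
      using f by (intro holomorphic_intros)
    have deriv: "deriv (\<lambda>z. of_real B * f z) z = of_real B * deriv f z" if "z \<in> unit_disk" for z
      using f that by (intro deriv_cmult holomorphic_on_imp_differentiable_at) auto
    have bound: "hardy_mean p (volterra_S g f) r \<le> C * B powr p * L" if r: "0 \<le> r" "r < 1" for r
    proof -
      have "hardy_mean p (volterra_S g f) r \<le> C * hardy_mean p (\<lambda>z. of_real B * f z) r"
      proof (rule C(2)[OF hol S(1,2) _ r])
        fix z assume z: "z \<in> unit_disk"
        have "cmod (deriv f z) * cmod (g z) \<le> cmod (deriv f z) * B"
          using B(2)[OF z] by (intro mult_left_mono) auto
        then show "cmod (deriv (volterra_S g f) z) \<le> cmod (deriv (\<lambda>z. of_real B * f z) z)"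
          using B(1) z by (simp add: S(3) deriv norm_mult mult.commute)
      qed
      also have "hardy_mean p (\<lambda>z. of_real B * f z) r = B powr p * hardy_mean p f r"
        using B(1) by (simp add: hardy_mean_def norm_mult powr_mult)
      also have "C * (B powr p * hardy_mean p f r) \<le> C * (B powr p * L)"
        using C(1) L(3)[OF r] by (intro mult_left_mono) auto
      finally show ?thesis by (simp add: mult.assoc)
    qed
    have "(C * B powr p * L) powr (1 / p) = (C * B powr p) powr (1 / p) * L powr (1 / p)"
      by (rule powr_mult)
    then show ?thesis
      using hardy_space_boundedI[OF S(1) p bound] L(2) by simp
  qed
  then show ?thesis
    unfolding bounded_on_hardy_space_def by blast
qed

lemma bounded_symbol_if_volterra_S_bounded:
  assumes g: "g holomorphic_on unit_disk" and p: "0 < p" and bdd: "bounded_on_hardy_space p (volterra_S g)"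
  shows "g \<in> hardy_space_infinity"
proof -
  obtain C0 where mem: "\<And>f. f \<in> hardy_space p \<Longrightarrow> volterra_S g f \<in> hardy_space p"
    and C0: "\<And>f. f \<in> hardy_space p \<Longrightarrow> hardy_norm p (volterra_S g f) \<le> C0 * hardy_norm p f"
    using bdd unfolding bounded_on_hardy_space_def by blast
  \<comment> \<open>The given constant may be negative; its absolute value allows multiplication of
    inequalities.\<close>
  define C where "C = \<bar>C0\<bar>"
  have C: "0 \<le> C" by (simp add: C_def)
  define K where "K = 4 * p * 16 powr (1 / p) * C"
  \<comment> \<open>The derivative of the test function at \<open>a\<close> carries the factor |a|,
    which degenerates at 0; the disk |a| \<le> 1/2 is left to compactness.\<close>
  have outer: "cmod (g a) \<le> K" if a: "1 / 2 \<le> cmod a" "cmod a < 1" for a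
  proof -
    define f where "f = test_function p a"
    define D where "D = 1 - cmod a"
    \<comment> \<open>The test function yields powers of E = 1 - |a|^2, the growth estimate powers
      of D = 1 - |a|; they are comparable because D \<le> E \<le> 2 D.\<close>
    define E where "E = 1 - (cmod a)\<^sup>2"
    have D: "0 < D" using a by (simp add: D_def)
    have "E = D * (1 + cmod a)" by (simp add: D_def E_def power2_eq_square algebra_simps)
    moreover have "D * 1 \<le> D * (1 + cmod a)" "D * (1 + cmod a) \<le> D * 2"
      using D a by (intro mult_left_mono; simp)+
    ultimately have E: "D \<le> E" "E \<le> 2 * D" "0 < E" using D by linarith+
    have f: "f \<in> hardy_space p" "hardy_norm p f \<le> (1 / E) powr (1 / p)"
      unfolding f_def E_def by (rule test_function_hardy_space[OF a(2) p])+
    have hf: "f holomorphic_on unit_disk"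
      using f(1) by (simp add: hardy_space_def)
    have aa: "cnj a * a = of_real ((cmod a)\<^sup>2)"
      unfolding complex_norm_square by (rule mult.commute)
    have oneE: "1 - cnj a * a = of_real E"
      by (simp add: aa E_def)
    have "deriv f a = f a * (2 / of_real p * cnj a / of_real E)"
      using has_field_derivative_test_function[OF a(2) a(2) p] oneE
      by (simp add: f_def DERIV_imp_deriv)
    moreover have "cmod (f a) = E powr (- 2 / p)"
      using cmod_test_function[OF a(2) a(2) p] oneE E by (simp add: f_def)
    ultimately have df: "cmod (deriv f a) = E powr (- 2 / p) * (2 / p * cmod a / E)"
      using p E by (simp add: norm_mult norm_divide)
    have "hardy_norm p (volterra_S g f) \<le> C * hardy_norm p f"
    proof -
      have "0 \<le> hardy_norm p f" by (simp add: hardy_norm_def)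
      then have "C0 * hardy_norm p f \<le> C * hardy_norm p f"
        by (intro mult_right_mono) (simp_all add: C_def)
      then show ?thesis using C0[OF f(1)] by linarith
    qed
    also have "\<dots> \<le> C * (1 / E) powr (1 / p)"
      using f(2) C by (intro mult_left_mono)
    finally have n: "hardy_norm p (volterra_S g f) \<le> C * (1 / E) powr (1 / p)" .
    have "cmod (deriv f a) * cmod (g a) = cmod (deriv (volterra_S g f) a)"
      using volterra_S_properties(3)[OF hf g] a by (simp add: norm_mult)
    also have "\<dots> \<le> 2 * (8 / D) powr (1 / p) * hardy_norm p (volterra_S g f) / D"
      unfolding D_def by (rule hardy_space_deriv_bound[OF mem[OF f(1)] p a(2)])
    also have "\<dots> \<le> 2 * (16 / E) powr (1 / p) * (C * (1 / E) powr (1 / p)) / (E / 2)"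
    proof (rule frac_le)
      have "8 / D \<le> 16 / E" using D E by (simp add: field_simps)
      then have "(8 / D) powr (1 / p) \<le> (16 / E) powr (1 / p)"
        using p D by (intro powr_mono2) auto
      then show "2 * (8 / D) powr (1 / p) * hardy_norm p (volterra_S g f)
          \<le> 2 * (16 / E) powr (1 / p) * (C * (1 / E) powr (1 / p))"
        by (intro mult_mono n) (auto simp: hardy_norm_def)
    qed (use C E in auto)
    also have "\<dots> = 4 * 16 powr (1 / p) * C * (E powr (- 2 / p) / E)"
    proof -
      have "(1 / E) powr (1 / p) = E powr (- 1 / p)"
        using E by (simp add: powr_divide powr_minus_divide)
      then have "(1 / E) powr (1 / p) * (1 / E) powr (1 / p) = E powr (- 1 / p + - 1 / p)"
        by (simp only: powr_add)
      also have "- 1 / p + - 1 / p = - 2 / p" by simp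
      finally have "(1 / E) powr (1 / p) * (1 / E) powr (1 / p) = E powr (- 2 / p)" .
      moreover have "(16 / E) powr (1 / p) = 16 powr (1 / p) * (1 / E) powr (1 / p)"
        using E by (simp add: powr_divide)
      ultimately show ?thesis by (simp add: algebra_simps)
    qed
    \<comment> \<open>Both sides carry the same power of \<open>E\<close>, which cancels; what is
      left is independent of the distance of \<open>a\<close> to the circle.\<close>
    finally have "(E powr (- 2 / p) / E) * (2 / p * cmod a * cmod (g a)) \<le> (E powr (- 2 / p) / E) * (4 * 16 powr (1 / p) * C)"
      by (simp add: df algebra_simps)
    then have "2 / p * cmod a * cmod (g a) \<le> 4 * 16 powr (1 / p) * C"
      by (rule mult_left_le_imp_le) (use E in simp)
    then have "cmod a * cmod (g a) \<le> K / 2"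
      using p by (simp add: K_def field_simps)
    moreover have "1 / 2 * cmod (g a) \<le> cmod a * cmod (g a)"
      using a by (intro mult_right_mono) auto
    ultimately show ?thesis by linarith
  qed
  have "continuous_on (cball 0 (1/2)) g"
    by (rule holomorphic_on_imp_continuous_on[OF holomorphic_on_subset[OF g]]) auto
  then have "bounded (g ` cball 0 (1/2))"
    by (intro compact_imp_bounded compact_continuous_image) auto
  then obtain B where B: "\<And>z. cmod z \<le> 1 / 2 \<Longrightarrow> cmod (g z) \<le> B"
    unfolding bounded_iff by (metis imageI mem_cball_0)
  have "cmod (g z) \<le> max B K" if "z \<in> unit_disk" for z
    using B[of z] outer[of z] that by (cases "cmod z \<le> 1 / 2") auto
  then have "bounded (g ` unit_disk)"
    unfolding bounded_iff by blast
  then show ?thesis using g by (simp add: hardy_space_infinity_def)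
qed

theorem proposition1:
  fixes g :: "complex \<Rightarrow> complex" and p :: real
  assumes "g holomorphic_on unit_disk" and "0 < p"
  shows "bounded_on_hardy_space p (volterra_S g) \<longleftrightarrow> g \<in> hardy_space_infinity"
  using bounded_symbol_if_volterra_S_bounded[OF assms] volterra_S_bounded_if_bounded_symbol[OF _ assms(2)] by blast

end
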